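(* Let $d\ge 2$. Any finite Ferrers $d$-partite $d$-uniform hypergraph $F$ obeys the colex lower bound; that is, the ideal $I(F)$ satisfies $\beta_i(I(F))\ge\beta_i(J)$ for all $i$, where $J$ is the unique colexsegment-generated squarefree monomial ideal generated in degree $d$ with the same number of minimal generators as $I(F)$.
   Context: A $d$-partite $d$-uniform hypergraph on a partitioned vertex set $X^{(1)}\sqcup\dots\sqcup X^{(d)}$ is identified with a subset $F\subseteq X^{(1)}\times\cdots\times X^{(d)}$. It is a Ferrers hypergraph if there is a linear ordering on each $X^{(j)}$ such that $F$ is an order ideal (down-set) in the componentwise partial order on $X^{(1)}\times\cdots\times X^{(d)}$. Let $k$ be a field; $I(F)$ is the ideal generated by the monomials $x^{(1)}_{i_1}\cdots x^{(d)}_{i_d}$, $(i_1,\dots,i_d)\in F$, in the polynomial ring over $k$ with one variable $x^{(j)}_i$ for each $i\in X^{(j)}$, $1\le j\le d$. Colexicographic order on $d$-subsets of $\mathbb P=\{1,2,\dots\}$: for $S=\{i_1<\dots<i_d\}$, $S'=\{i_1'<\dots<i_d'\}$, $S<_{colex}S'$ if $i_m<i_m'$ for some $m$ and $i_j=i_j'$ for all $j>m$. A colexsegment-generated ideal is $J=(x_{i_1}\cdots x_{i_d}:\{i_1,\dots,i_d\}\in C)$, in a polynomial ring over $k$, with $C$ a finite initial segment of the colex order on $\binom{\mathbb P}{d}$. $\beta_i(I)=\dim_k\mathrm{Tor}_i^S(I,k)$ over the ambient polynomial ring $S$. *)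

theory Defs
  imports
    "HOL-Library.Poly_Mapping"
    "HOL-Library.FuncSet"
    "HOL-Algebra.Ideal"
    "Jordan_Normal_Form.Matrix_Kernel"
    "Jordan_Normal_Form.DL_Rank"
begin

section \<open>Polynomial rings and monomial ideals\<close>

type_synonym ('v, 'k) mpoly = "('v \<Rightarrow>\<^sub>0 nat) \<Rightarrow>\<^sub>0 'k"

text \<open>The polynomial ring over \<open>'k\<close> whose variables are the elements of \<open>V\<close>, as a subring of
  the ring of polynomials in all variables of type \<open>'v\<close>.\<close>

definition poly_ring :: "'v set \<Rightarrow> ('v, 'k::field) mpoly ring" where
  "poly_ring V = \<lparr>carrier = {f. \<forall>m \<in> Poly_Mapping.keys f. Poly_Mapping.keys m \<subseteq> V},
     mult = (*), one = 1, zero = 0, add = (+)\<rparr>"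

definition var :: "'v \<Rightarrow> ('v, 'k::field) mpoly" where
  "var v = Poly_Mapping.single (Poly_Mapping.single v 1) 1"

text \<open>Exponent vectors of the minimal monomial generators of a monomial ideal. Divisibility is
  spelled out pointwise because the order that the library puts on \<open>\<Rightarrow>\<^sub>0\<close> is lexicographic.\<close>

definition min_gens :: "('v, 'k::field) mpoly set \<Rightarrow> ('v \<Rightarrow>\<^sub>0 nat) set" where
  "min_gens I = {m. Poly_Mapping.single m 1 \<in> I \<and>
     (\<forall>m'. Poly_Mapping.single m' 1 \<in> I \<longrightarrow>
        (\<forall>v. Poly_Mapping.lookup m' v \<le> Poly_Mapping.lookup m v) \<longrightarrow> m' = m)}"


section \<open>Betti numbers\<close>

definition free_module :: "'v set \<Rightarrow> nat \<Rightarrow> ('v, 'k::field) mpoly vec set" where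
  "free_module V n = {v \<in> carrier_vec n. \<forall>a < n. v $ a \<in> carrier (poly_ring V)}"

text \<open>With \<open>S = poly_ring V\<close>: an exact sequence
  \<open>\<dots> \<rightarrow> S^(r 2) \<rightarrow> S^(r 1) \<rightarrow> S^(r 0) \<rightarrow> I \<rightarrow> 0\<close>.
  For \<open>p \<ge> 1\<close>, \<open>D p\<close> is the matrix of \<open>S^(r p) \<rightarrow> S^(r (p - 1))\<close>; \<open>D 0\<close> is the single row of
  the augmentation \<open>S^(r 0) \<rightarrow> S\<close>, which has image \<open>I\<close>. Finite ranks lose nothing for ideals
  generated by finitely many monomials, even when \<open>V\<close> is infinite.\<close>

definition free_resolution ::
  "'v set \<Rightarrow> ('v, 'k::field) mpoly set \<Rightarrow> (nat \<Rightarrow> nat) \<Rightarrow> (nat \<Rightarrow> ('v, 'k) mpoly mat) \<Rightarrow> bool" where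
  "free_resolution V I r D \<longleftrightarrow>
     (\<forall>p. D p \<in> carrier_mat (case p of 0 \<Rightarrow> 1 | Suc q \<Rightarrow> r q) (r p) \<and>
          elements_mat (D p) \<subseteq> carrier (poly_ring V)) \<and>
     (\<lambda>v. (D 0 *\<^sub>v v) $ 0) ` free_module V (r 0) = I \<and>
     (\<forall>p. (\<lambda>v. D (Suc p) *\<^sub>v v) ` free_module V (r (Suc p)) =
          mat_kernel (D p) \<inter> free_module V (r p))"

text \<open>The complex of \<open>k\<close>-vector spaces obtained from a resolution by deleting \<open>I\<close> and tensoring
  with \<open>k = S / (all variables)\<close>: the term \<open>S^(r p)\<close> becomes \<open>k^(r p)\<close> and every matrix entry is
  replaced by its constant term. The map out of degree \<open>0\<close> is zero.\<close>

definition tensored_map ::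
  "(nat \<Rightarrow> nat) \<Rightarrow> (nat \<Rightarrow> ('v, 'k::field) mpoly mat) \<Rightarrow> nat \<Rightarrow> 'k mat" where
  "tensored_map r D p =
     (case p of 0 \<Rightarrow> 0\<^sub>m 0 (r 0) | Suc q \<Rightarrow> map_mat (\<lambda>f. Poly_Mapping.lookup f 0) (D (Suc q)))"

text \<open>The dimension of the homology (cycles modulo boundaries) in degree \<open>i\<close> of that complex.\<close>

definition tor_dim ::
  "(nat \<Rightarrow> nat) \<Rightarrow> (nat \<Rightarrow> ('v, 'k::field) mpoly mat) \<Rightarrow> nat \<Rightarrow> nat" where
  "tor_dim r D i =
     kernel_dim (tensored_map r D i) - vec_space.rank (r i) (tensored_map r D (Suc i))"

text \<open>\<open>\<beta>\<^sub>i(I) = dim Tor\<^sub>i(I, k)\<close> over \<open>poly_ring V\<close>; Tor does not depend on the resolution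
  used to compute it, so an arbitrary one is chosen.\<close>

definition betti :: "'v set \<Rightarrow> ('v, 'k::field) mpoly set \<Rightarrow> nat \<Rightarrow> nat" where
  "betti V I i = (case (SOME (r, D). free_resolution V I r D) of (r, D) \<Rightarrow> tor_dim r D i)"


section \<open>Ferrers hypergraphs\<close>

text \<open>An edge is a tuple \<open>f\<close> with \<open>f j \<in> X j\<close> for \<open>1 \<le> j \<le> d\<close>.\<close>

definition ferrers_hypergraph :: "nat \<Rightarrow> (nat \<Rightarrow> 'a set) \<Rightarrow> (nat \<Rightarrow> 'a) set \<Rightarrow> bool" where
  "ferrers_hypergraph d X F \<longleftrightarrow>
     F \<subseteq> (\<Pi>\<^sub>E j\<in>{1..d}. X j) \<and>
     (\<exists>le :: nat \<Rightarrow> 'a rel.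
        (\<forall>j\<in>{1..d}. linear_order_on (X j) (le j)) \<and>
        (\<forall>f\<in>F. \<forall>g\<in>(\<Pi>\<^sub>E j\<in>{1..d}. X j). (\<forall>j\<in>{1..d}. (g j, f j) \<in> le j) \<longrightarrow> g \<in> F))"

text \<open>The disjoint union of the vertex classes; the variable attached to \<open>i \<in> X j\<close> is \<open>(j, i)\<close>.\<close>

definition hypergraph_vars :: "nat \<Rightarrow> (nat \<Rightarrow> 'a set) \<Rightarrow> (nat \<times> 'a) set" where
  "hypergraph_vars d X = (SIGMA j:{1..d}. X j)"

definition hypergraph_ideal ::
  "nat \<Rightarrow> (nat \<Rightarrow> 'a set) \<Rightarrow> (nat \<Rightarrow> 'a) set \<Rightarrow> (nat \<times> 'a, 'k::field) mpoly set" where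
  "hypergraph_ideal d X F =
     genideal (poly_ring (hypergraph_vars d X)) ((\<lambda>f. \<Prod>j\<in>{1..d}. var (j, f j)) ` F)"


section \<open>Colexsegment-generated ideals\<close>

definition d_subsets :: "nat \<Rightarrow> nat set set" where
  "d_subsets d = {S. S \<subseteq> {1..} \<and> finite S \<and> card S = d}"

text \<open>Positions in the increasing enumeration are counted from \<open>0\<close>.\<close>

definition colex_less :: "nat \<Rightarrow> nat set \<Rightarrow> nat set \<Rightarrow> bool" where
  "colex_less d S S' \<longleftrightarrow>
     (\<exists>m<d. sorted_list_of_set S ! m < sorted_list_of_set S' ! m \<and>
        (\<forall>j. m < j \<and> j < d \<longrightarrow> sorted_list_of_set S ! j = sorted_list_of_set S' ! j))"

definition colex_initial_segment :: "nat \<Rightarrow> nat set set \<Rightarrow> bool" where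
  "colex_initial_segment d C \<longleftrightarrow>
     C \<subseteq> d_subsets d \<and> (\<forall>S\<in>C. \<forall>S'\<in>d_subsets d. colex_less d S' S \<longrightarrow> S' \<in> C)"

definition colexsegment_generated :: "nat \<Rightarrow> nat set \<Rightarrow> (nat, 'k::field) mpoly set \<Rightarrow> bool" where
  "colexsegment_generated d V J \<longleftrightarrow>
     (\<exists>C. finite C \<and> colex_initial_segment d C \<and> \<Union>C \<subseteq> V \<and>
        J = genideal (poly_ring V) ((\<lambda>S. \<Prod>i\<in>S. var i) ` C))"

end

theory Submission
  imports Defs
begin

text \<open>Both ideals have \<^emph>\<open>linear quotients\<close>: their minimal monomial generators can be listed
  so that the colon ideal of the preceding generators by the next one is generated by variables.
  If \<open>q a\<close> is the number of these variables for the generator \<open>a\<close>, the \<open>i\<close>-th Betti number is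
  the sum of the binomial coefficients \<open>q a choose i\<close> over all generators
  (\<open>linear_resolution_linear_quotients\<close> with \<open>betti_linear_resolution\<close>). It remains to compare two
  multisets of numbers.

  For a Ferrers hypergraph, list the edges by \<open>weight\<close>, the total number of vertices that lie
  below the vertices of the edge in their classes. Replacing a vertex of an edge \<open>f\<close> by a smaller one
  gives a lighter edge, and an edge that is different from \<open>f\<close> and not heavier has some vertex
  below the corresponding vertex of \<open>f\<close>. So the colon ideal at \<open>f\<close> is generated by the variables of the vertices below
  the vertices of \<open>f\<close>, and \<open>q f\<close> is the weight. For a colex segment, list the sets by their maximum.
  Replacing the maximum of \<open>S\<close> by a smaller positive number outside \<open>S\<close> gives an earlier set, so
  \<open>q S\<close> counts the positive numbers below \<open>Max S\<close> outside \<open>S\<close>; this is \<open>Max S - d\<close>.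

  The edge with \<open>n\<^sub>1, \<dots>, n\<^sub>d\<close> vertices below its vertices is encoded as the \<open>d\<close>-set with the elements
  \<open>n\<^sub>1 + \<dots> + n\<^sub>j + j\<close>, where \<open>j\<close> runs from 1 to \<open>d\<close>. The encoding is injective, and its maximum
  is the weight plus \<open>d\<close>. Thus \<open>F\<close> becomes a family \<open>T\<close> of \<open>d\<close>-sets, as large as the colex segment \<open>C\<close>.
  Colex order refines the order by maxima, so pairing \<open>C - T\<close> with \<open>T - C\<close> arbitrarily never
  decreases the maximum (\<open>colex_initial_segment_Max_minimal\<close>), and \<open>q choose i\<close> is monotone in \<open>q\<close>.

  The Betti numbers come from resolutions. Adding a monomial \<open>m\<close> to an ideal \<open>I\<close> gives a quotient
  \<open>(I + (m)) / I\<close> isomorphic, up to a degree shift, to the ring modulo the colon ideal \<open>Q\<close> of \<open>I\<close>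
  by \<open>m\<close>. Resolutions of \<open>I\<close> and of \<open>Q\<close> are glued along a chain map that lifts the
  multiplication by \<open>m\<close> (\<open>resolution_extend\<close>). Taking homogeneous parts of degree 1 makes all
  matrices linear (\<open>linear_resolution_extend\<close>), hence their constant terms vanish. Ideals generated by
  variables arise from the same step, and so their resolutions, the Koszul complexes, need no separate construction.
  Finally, \<open>betti\<close> refers to an arbitrary resolution. It is homotopy equivalent to the linear one,
  and reduction to constant terms turns this equivalence into an isomorphism between its homology
  and vector spaces whose dimensions are the ranks of the linear resolution
  (\<open>kernel_dim_tensored_resolution\<close>).\<close>

section \<open>Homology of a complex of vector spaces\<close>

lemma zero_mat_mult_vec: "v \<in> carrier_vec m \<Longrightarrow> 0\<^sub>m n m *\<^sub>v v = (0\<^sub>v n :: 'a::semiring_1 vec)"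
  by (intro eq_vecI) (auto simp: scalar_prod_def)

lemma mat_mult_zero_vec: "A \<in> carrier_mat n m \<Longrightarrow> A *\<^sub>v 0\<^sub>v m = (0\<^sub>v n :: 'a::semiring_1 vec)"
  by (intro eq_vecI) (auto simp: scalar_prod_def)

text \<open>Multiplication by \<open>f\<close> maps the kernel of \<open>A\<close> onto the space of vectors of length \<open>s\<close>, because
\<open>g\<close> takes values in this kernel and is a right inverse. On the kernel of \<open>A\<close> the relation for
\<open>g * f\<close> loses its last term, so a vector that \<open>f\<close> sends to 0 lies in the image of \<open>B\<close>; the
converse is \<open>f * B = 0\<close>. Rank-nullity for this map gives the equation.\<close>

lemma kernel_dim_eq_add_rank:
  fixes A :: "'a::field mat"
  assumes A: "A \<in> carrier_mat a n" and B: "B \<in> carrier_mat n b"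
    and f: "f \<in> carrier_mat s n" and g: "g \<in> carrier_mat n s"
    and h: "h \<in> carrier_mat b n" and h': "h' \<in> carrier_mat n a"
    and AB: "A * B = 0\<^sub>m a b" and Ag: "A * g = 0\<^sub>m a s" and fB: "f * B = 0\<^sub>m s b"
    and fg: "f * g = 1\<^sub>m s" and gf: "g * f = 1\<^sub>m n + (B * h + h' * A)"
  shows "kernel_dim A = s + vec_space.rank n B"
proof -
  interpret K: kernel a n A by (unfold_locales, rule A)
  interpret W: vec_space "TYPE('a)" s .
  have lm: "linear_map class_ring K.VK W.V (\<lambda>v. f *\<^sub>v v)"
  proof (intro linear_map.intro mod_hom.intro mod_hom_axioms.intro)
    show "vectorspace class_ring K.VK" by (rule K.Ker.vectorspace_axioms)
    show "vectorspace class_ring W.V" by (rule W.vectorspace_axioms)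
    show "Module.module class_ring K.VK" by (rule K.Ker.module_axioms)
    show "Module.module class_ring W.V" by (rule W.module_axioms)
    show "(\<lambda>v. f *\<^sub>v v) \<in> LinearCombinations.module_hom class_ring K.VK W.V"
      using f mat_kernelD[OF A]
      by (auto simp: LinearCombinations.module_hom_def mult_add_distrib_mat_vec[OF f] mult_mat_vec[OF f] module_vec_simps)
  qed
  interpret L: linear_map class_ring K.VK W.V "\<lambda>v. f *\<^sub>v v" by (rule lm)
  have fd: "K.Ker.fin_dim"
    using kernel_basis_exists[OF A] K.Ker.basis_def K.Ker.fin_dim_def by auto
  have im: "L.imT = carrier_vec s"
  proof
    show "L.imT \<subseteq> carrier_vec s" using f mat_kernelD[OF A] by (auto simp: L.im_def)
    show "carrier_vec s \<subseteq> L.imT"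
    proof
      fix w :: "'a vec" assume w: "w \<in> carrier_vec s"
      have gw: "g *\<^sub>v w \<in> carrier_vec n" using g w by auto
      have "A *\<^sub>v (g *\<^sub>v w) = (A * g) *\<^sub>v w" using A g w by simp
      also have "\<dots> = 0\<^sub>v a" using w by (simp add: Ag zero_mat_mult_vec)
      finally have 1: "g *\<^sub>v w \<in> mat_kernel A" using mat_kernelI[OF A gw] by simp
      have "f *\<^sub>v (g *\<^sub>v w) = (f * g) *\<^sub>v w" using f g w by simp
      also have "\<dots> = w" using w by (simp add: fg)
      finally show "w \<in> L.imT" using 1 unfolding L.im_def by (simp add: image_def) (metis)
    qed
  qed
  have ker: "L.kerT = K.NC.col_space B"
  proof
    show "K.NC.col_space B \<subseteq> L.kerT"
    proof
      fix v assume "v \<in> K.NC.col_space B"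
      then obtain x where x: "x \<in> carrier_vec b" and v: "v = B *\<^sub>v x"
        using K.NC.col_space_eq[OF B] B by auto
      have 1: "v \<in> carrier_vec n" using x v B by auto
      have "A *\<^sub>v v = (A * B) *\<^sub>v x" using A B x v by simp
      also have "\<dots> = 0\<^sub>v a" using x by (simp add: AB zero_mat_mult_vec)
      finally have 2: "v \<in> mat_kernel A" using mat_kernelI[OF A 1] by simp
      have "f *\<^sub>v v = (f * B) *\<^sub>v x" using f B x v by simp
      also have "\<dots> = 0\<^sub>v s" using x by (simp add: fB zero_mat_mult_vec)
      finally show "v \<in> L.kerT" using 2 unfolding L.ker_def by (simp add: module_vec_simps)
    qed
    show "L.kerT \<subseteq> K.NC.col_space B"
    proof
      fix v assume "v \<in> L.kerT"
      then have v1: "v \<in> mat_kernel A" and fv: "f *\<^sub>v v = 0\<^sub>v s"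
        unfolding L.ker_def by (simp_all add: module_vec_simps)
      have v: "v \<in> carrier_vec n" and Av: "A *\<^sub>v v = 0\<^sub>v a" using mat_kernelD[OF A v1] by auto
      have "0\<^sub>v n = g *\<^sub>v (f *\<^sub>v v)" using fv g by (simp add: mat_mult_zero_vec)
      also have "\<dots> = (g * f) *\<^sub>v v" using f g v by simp
      also have "\<dots> = v + (B *\<^sub>v (h *\<^sub>v v) + h' *\<^sub>v (A *\<^sub>v v))"
        using A B h h' v unfolding gf
        by (simp add: add_mult_distrib_mat_vec[of _ n n] assoc_mult_mat_vec[of _ n b _ n] assoc_mult_mat_vec[of _ n a _ n])
      also have "\<dots> = v + B *\<^sub>v (h *\<^sub>v v)" using B h h' v Av by (simp add: mat_mult_zero_vec)
      finally have e: "0\<^sub>v n = v + B *\<^sub>v (h *\<^sub>v v)" .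
      have "v = - 1 \<cdot>\<^sub>v (B *\<^sub>v (h *\<^sub>v v))"
      proof (rule eq_vecI)
        fix i assume "i < dim_vec (- 1 \<cdot>\<^sub>v (B *\<^sub>v (h *\<^sub>v v)))"
        then have i: "i < n" using B by simp
        then have "(v + B *\<^sub>v (h *\<^sub>v v)) $ i = 0" by (simp flip: e)
        then show "v $ i = (- 1 \<cdot>\<^sub>v (B *\<^sub>v (h *\<^sub>v v))) $ i"
          using i v B h by (simp add: eq_neg_iff_add_eq_0)
      qed (use v B in simp)
      also have "\<dots> = B *\<^sub>v (- 1 \<cdot>\<^sub>v (h *\<^sub>v v))" using B h v by (simp add: mult_mat_vec)
      finally have "v = B *\<^sub>v (- 1 \<cdot>\<^sub>v (h *\<^sub>v v))" .
      then have "B *\<^sub>v (- 1 \<cdot>\<^sub>v (h *\<^sub>v v)) = v" by simp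
      moreover have "- 1 \<cdot>\<^sub>v (h *\<^sub>v v) \<in> carrier_vec b" using h v by simp
      ultimately show "v \<in> K.NC.col_space B"
        unfolding K.NC.col_space_eq[OF B] carrier_matD[OF B] using v by blast
    qed
  qed
  have "vectorspace.dim class_ring (W.V\<lparr>carrier := L.imT\<rparr>) + vectorspace.dim class_ring (K.VK\<lparr>carrier := L.kerT\<rparr>) = K.Ker.dim"
    by (rule L.rank_nullity[OF fd])
  moreover have "W.V\<lparr>carrier := L.imT\<rparr> = W.V" unfolding im by (simp add: module_vec_def)
  moreover have "vectorspace.dim class_ring (K.VK\<lparr>carrier := L.kerT\<rparr>) = vec_space.rank n B"
    unfolding ker K.NC.rank_def K.NC.col_space_def by simp
  ultimately show ?thesis using W.dim_is_n K.kernel_dim by simp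
qed

section \<open>Free resolutions over a subring\<close>

text \<open>The polynomials in the variables \<open>V\<close> form a subset of a type, not a type. Matrices therefore
have entries in the ambient type, and membership of the entries in the subring is tracked by
\<open>mats\<close> and \<open>vecs\<close>.\<close>

locale scalar_subring =
  fixes R :: "'a::comm_ring_1 set"
  assumes zero_closed: "0 \<in> R" and one_closed: "1 \<in> R"
    and add_closed: "x \<in> R \<Longrightarrow> y \<in> R \<Longrightarrow> x + y \<in> R"
    and mult_closed: "x \<in> R \<Longrightarrow> y \<in> R \<Longrightarrow> x * y \<in> R"
    and uminus_closed: "x \<in> R \<Longrightarrow> - x \<in> R"
begin

definition vecs :: "nat \<Rightarrow> 'a vec set" where
  "vecs n = {v \<in> carrier_vec n. \<forall>i<n. v $ i \<in> R}"

definition mats :: "nat \<Rightarrow> nat \<Rightarrow> 'a mat set" where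
  "mats n m = {A \<in> carrier_mat n m. \<forall>i<n. \<forall>j<m. A $$ (i, j) \<in> R}"

lemma vecsD: "v \<in> vecs n \<Longrightarrow> v \<in> carrier_vec n"
  by (simp add: vecs_def)

lemma matsD: "A \<in> mats n m \<Longrightarrow> A \<in> carrier_mat n m"
  by (simp add: mats_def)

lemma sum_closed: "(\<And>x. x \<in> S \<Longrightarrow> f x \<in> R) \<Longrightarrow> sum f S \<in> R"
  by (induct S rule: infinite_finite_induct) (auto simp: zero_closed add_closed)

lemma mats_mult: "A \<in> mats n m \<Longrightarrow> B \<in> mats m l \<Longrightarrow> A * B \<in> mats n l"
  by (auto simp: mats_def scalar_prod_def intro!: sum_closed mult_closed)

lemma mats_mult_vec: "A \<in> mats n m \<Longrightarrow> v \<in> vecs m \<Longrightarrow> A *\<^sub>v v \<in> vecs n"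
  by (auto simp: mats_def vecs_def scalar_prod_def intro!: sum_closed mult_closed)

lemma mats_add: "A \<in> mats n m \<Longrightarrow> B \<in> mats n m \<Longrightarrow> A + B \<in> mats n m"
  by (auto simp: mats_def intro!: add_closed)

lemma mats_uminus: "A \<in> mats n m \<Longrightarrow> - A \<in> mats n m"
  by (auto simp: mats_def intro!: uminus_closed)

lemma mats_minus: "A \<in> mats n m \<Longrightarrow> B \<in> mats n m \<Longrightarrow> A - B \<in> mats n m"
  using add_closed[OF _ uminus_closed] by (auto simp: mats_def)

lemma mats_one: "1\<^sub>m n \<in> mats n n"
  by (auto simp: mats_def zero_closed one_closed)

lemma mats_zero: "0\<^sub>m n m \<in> mats n m"
  by (auto simp: mats_def zero_closed)

lemma mats_col: "A \<in> mats n m \<Longrightarrow> j < m \<Longrightarrow> col A j \<in> vecs n"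
  by (auto simp: mats_def vecs_def)

lemma vecs_add: "v \<in> vecs n \<Longrightarrow> w \<in> vecs n \<Longrightarrow> v + w \<in> vecs n"
  by (auto simp: vecs_def intro!: add_closed)

lemma vecs_minus: "v \<in> vecs n \<Longrightarrow> w \<in> vecs n \<Longrightarrow> v - w \<in> vecs n"
  using add_closed[OF _ uminus_closed] by (auto simp: vecs_def)

lemma vecs_append: "v \<in> vecs n \<Longrightarrow> w \<in> vecs m \<Longrightarrow> v @\<^sub>v w \<in> vecs (n + m)"
  by (auto simp: vecs_def)

lemma mats_four_block:
  "A \<in> mats n1 m1 \<Longrightarrow> B \<in> mats n1 m2 \<Longrightarrow> C \<in> mats n2 m1 \<Longrightarrow> D \<in> mats n2 m2 \<Longrightarrow>
    four_block_mat A B C D \<in> mats (n1 + n2) (m1 + m2)"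
  by (auto simp: mats_def)

text \<open>The columns of \<open>C\<close> are solutions of the equations for the single columns of \<open>B\<close>. This turns
elementwise exactness into the existence of matrices.\<close>

lemma mat_solve:
  assumes A: "A \<in> carrier_mat n m" and B: "B \<in> carrier_mat n l"
    and ex: "\<And>j. j < l \<Longrightarrow> \<exists>v\<in>vecs m. A *\<^sub>v v = col B j"
  shows "\<exists>C\<in>mats m l. A * C = B"
proof -
  from ex obtain v where v: "\<And>j. j < l \<Longrightarrow> v j \<in> vecs m \<and> A *\<^sub>v v j = col B j" by metis
  define C where "C = mat m l (\<lambda>(i, j). v j $ i)"
  have C: "C \<in> mats m l" using v by (auto simp: C_def mats_def vecs_def)
  have col: "col C j = v j" if "j < l" for j
    using v[OF that] that by (auto simp: C_def vecs_def)
  have "A * C = B"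
  proof (rule eq_matI)
    fix i j assume "i < dim_row B" "j < dim_col B"
    then have ij: "i < n" "j < l" using B by auto
    have "(A * C) $$ (i, j) = (A *\<^sub>v v j) $ i" using ij A C col by (simp add: C_def)
    also have "\<dots> = B $$ (i, j)" using v[OF ij(2)] ij B by simp
    finally show "(A * C) $$ (i, j) = B $$ (i, j)" .
  qed (use A B in \<open>auto simp: C_def\<close>)
  with C show ?thesis by blast
qed

text \<open>The value 1 at \<open>p = 0\<close> is the rank of the ring itself, the target of the augmentation.\<close>

abbreviation (input) target_rank :: "(nat \<Rightarrow> nat) \<Rightarrow> nat \<Rightarrow> nat" where
  "target_rank r p \<equiv> (case p of 0 \<Rightarrow> 1 | Suc q \<Rightarrow> r q)"

definition resolution :: "'a set \<Rightarrow> (nat \<Rightarrow> nat) \<Rightarrow> (nat \<Rightarrow> 'a mat) \<Rightarrow> bool" where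
  "resolution I r D \<longleftrightarrow>
     (\<forall>p. D p \<in> mats (target_rank r p) (r p)) \<and>
     (\<lambda>v. (D 0 *\<^sub>v v) $ 0) ` vecs (r 0) = I \<and>
     (\<forall>p. (\<lambda>v. D (Suc p) *\<^sub>v v) ` vecs (r (Suc p)) = mat_kernel (D p) \<inter> vecs (r p))"

lemma resolution_mats: "resolution I r D \<Longrightarrow> D p \<in> mats (target_rank r p) (r p)"
  by (simp add: resolution_def)

lemma resolution_mats_0: "resolution I r D \<Longrightarrow> D 0 \<in> mats 1 (r 0)"
  using resolution_mats[of I r D 0] by simp

lemma resolution_mats_Suc: "resolution I r D \<Longrightarrow> D (Suc p) \<in> mats (r p) (r (Suc p))"
  using resolution_mats[of I r D "Suc p"] by simp

lemma resolution_complex: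
  assumes "resolution I r D"
  shows "D p * D (Suc p) = 0\<^sub>m (target_rank r p) (r (Suc p))"
proof (rule eq_matI)
  note D = resolution_mats[OF assms] and D' = resolution_mats_Suc[OF assms]
  fix i j assume "i < dim_row (0\<^sub>m (target_rank r p) (r (Suc p)) :: 'a mat)"
    "j < dim_col (0\<^sub>m (target_rank r p) (r (Suc p)) :: 'a mat)"
  then have ij: "i < target_rank r p" "j < r (Suc p)" by auto
  have u: "unit_vec (r (Suc p)) j \<in> vecs (r (Suc p))"
    by (auto simp: vecs_def unit_vec_def zero_closed one_closed)
  then have "D (Suc p) *\<^sub>v unit_vec (r (Suc p)) j \<in> mat_kernel (D p)"
    using assms by (auto simp: resolution_def)
  then have "D p *\<^sub>v (D (Suc p) *\<^sub>v unit_vec (r (Suc p)) j) = 0\<^sub>v (target_rank r p)"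
    using mat_kernelD[OF matsD[OF D]] by blast
  moreover have "D (Suc p) *\<^sub>v unit_vec (r (Suc p)) j = col (D (Suc p)) j"
    using matsD[OF D'[of p]] ij(2) by (intro eq_vecI) (auto)
  ultimately have "(D p *\<^sub>v col (D (Suc p)) j) $ i = 0" using ij by simp
  then show "(D p * D (Suc p)) $$ (i, j) = 0\<^sub>m (target_rank r p) (r (Suc p)) $$ (i, j)"
    using ij matsD[OF D[of p]] matsD[OF D'[of p]] by simp
qed (use matsD[OF resolution_mats[OF assms, of p]] matsD[OF resolution_mats_Suc[OF assms, of p]] in auto)

lemma resolution_lift:
  assumes res: "resolution I r D" and B: "B \<in> mats (r p) l"
    and z: "D p * B = 0\<^sub>m (target_rank r p) l"
  shows "\<exists>C\<in>mats (r (Suc p)) l. D (Suc p) * C = B"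
proof (rule mat_solve)
  note D = resolution_mats[OF res, of p]
  show "D (Suc p) \<in> carrier_mat (r p) (r (Suc p))" by (rule matsD[OF resolution_mats_Suc[OF res]])
  show "B \<in> carrier_mat (r p) l" by (rule matsD[OF B])
  fix j assume j: "j < l"
  have "D p *\<^sub>v col B j = col (D p * B) j"
    using matsD[OF D] matsD[OF B] j by (intro eq_vecI) auto
  also have "\<dots> = 0\<^sub>v (target_rank r p)" using j by (simp add: z)
  finally have "col B j \<in> mat_kernel (D p)"
    using mat_kernelI[OF matsD[OF D]] vecsD[OF mats_col[OF B j]] by blast
  with mats_col[OF B j] have "col B j \<in> (\<lambda>v. D (Suc p) *\<^sub>v v) ` vecs (r (Suc p))"
    using res by (auto simp: resolution_def)
  then show "\<exists>v\<in>vecs (r (Suc p)). D (Suc p) *\<^sub>v v = col B j" by auto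
qed

text \<open>Each square is filled by exactness of the resolution: the composite that has to be factored
lands in a kernel, which is an image. With \<open>c = 1\<close> this compares two resolutions of one
ideal; with a monomial \<open>c\<close> it provides the map along which two resolutions are glued.\<close>

lemma comparison_map:
  assumes res: "resolution I r D"
    and E: "\<And>p. E p \<in> mats (target_rank s p) (s p)"
    and EE: "\<And>p. E p * E (Suc p) = 0\<^sub>m (target_rank s p) (s (Suc p))"
    and c: "c \<in> R" and cE: "\<And>j. j < s 0 \<Longrightarrow> c * E 0 $$ (0, j) \<in> I"
  shows "\<exists>f. (\<forall>p. f p \<in> mats (r p) (s p)) \<and> D 0 * f 0 = c \<cdot>\<^sub>m E 0 \<and>
    (\<forall>p. D (Suc p) * f (Suc p) = f p * E (Suc p))"
proof -
  note D = resolution_mats[OF res] and D0 = resolution_mats_0[OF res]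
  note DS = resolution_mats_Suc[OF res]
  have E0: "E 0 \<in> mats 1 (s 0)" using E[of 0] by simp
  have ES: "E (Suc p) \<in> mats (s p) (s (Suc p))" for p using E[of "Suc p"] by simp
  define P where "P p F \<longleftrightarrow> F \<in> mats (r p) (s p) \<and> (p = 0 \<longrightarrow> D 0 * F = c \<cdot>\<^sub>m E 0) \<and>
    D p * (F * E (Suc p)) = 0\<^sub>m (target_rank r p) (s (Suc p))" for p F
  have "\<exists>F\<in>mats (r 0) (s 0). D 0 * F = c \<cdot>\<^sub>m E 0"
  proof (rule mat_solve)
    show "D 0 \<in> carrier_mat 1 (r 0)" by (rule matsD[OF D0])
    show cE0: "c \<cdot>\<^sub>m E 0 \<in> carrier_mat 1 (s 0)" using matsD[OF E0] by simp
    fix j assume j: "j < s 0"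
    from cE[OF j] obtain v where v: "v \<in> vecs (r 0)" "(D 0 *\<^sub>v v) $ 0 = c * E 0 $$ (0, j)"
      using res by (auto simp: resolution_def)
    have "D 0 *\<^sub>v v = col (c \<cdot>\<^sub>m E 0) j"
      using v(2) matsD[OF D0] matsD[OF E0] j by (intro eq_vecI) auto
    with v(1) show "\<exists>v\<in>vecs (r 0). D 0 *\<^sub>v v = col (c \<cdot>\<^sub>m E 0) j" by blast
  qed
  then obtain F0 where F0: "F0 \<in> mats (r 0) (s 0)" "D 0 * F0 = c \<cdot>\<^sub>m E 0" by blast
  have "D 0 * (F0 * E (Suc 0)) = (D 0 * F0) * E (Suc 0)"
    using assoc_mult_mat[OF matsD[OF D0] matsD[OF F0(1)] matsD[OF ES]] by simp
  also have "\<dots> = c \<cdot>\<^sub>m (E 0 * E (Suc 0))"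
    using mult_smult_assoc_mat[OF matsD[OF E0] matsD[OF ES]] by (simp add: F0(2))
  also have "\<dots> = 0\<^sub>m 1 (s (Suc 0))" by (simp add: EE smult_zero_mat)
  finally have P0: "P 0 F0" using F0 by (simp add: P_def)
  \<comment> \<open>\<open>P p F\<close> contains the cycle condition needed to continue with the next square.\<close>
  have "\<exists>f. \<forall>p. P p (f p) \<and> D (Suc p) * f (Suc p) = f p * E (Suc p)"
  proof (rule dependent_nat_choice)
    show "\<exists>F. P 0 F" using P0 by blast
    fix F p assume PF: "P p F"
    then have F: "F \<in> mats (r p) (s p)" by (simp add: P_def)
    from PF obtain G where G: "G \<in> mats (r (Suc p)) (s (Suc p))" "D (Suc p) * G = F * E (Suc p)"
      using resolution_lift[OF res mats_mult[OF F ES]] by (auto simp: P_def)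
    have "D (Suc p) * (G * E (Suc (Suc p))) = (D (Suc p) * G) * E (Suc (Suc p))"
      using assoc_mult_mat[OF matsD[OF DS] matsD[OF G(1)] matsD[OF ES]] by simp
    also have "\<dots> = F * (E (Suc p) * E (Suc (Suc p)))"
      unfolding G(2) using assoc_mult_mat[OF matsD[OF F] matsD[OF ES] matsD[OF ES]] .
    also have "\<dots> = 0\<^sub>m (r p) (s (Suc (Suc p)))"
      using EE[of "Suc p"] matsD[OF F] by simp
    finally show "\<exists>G. P (Suc p) G \<and> D (Suc p) * G = F * E (Suc p)"
      using G by (auto simp: P_def)
  qed
  then obtain f where f: "\<And>p. P p (f p)" "\<And>p. D (Suc p) * f (Suc p) = f p * E (Suc p)" by blast
  then show ?thesis by (intro exI[of _ f]) (auto simp: P_def)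
qed

text \<open>The homotopy is built degree by degree. The part of \<open>f\<close> that the homotopy does not yet account
for is annihilated by the differential and so factors through the next matrix.\<close>

lemma null_homotopy:
  assumes res: "resolution I r D"
    and f: "\<And>p. f p \<in> mats (r p) (r p)" and f0: "D 0 * f 0 = 0\<^sub>m 1 (r 0)"
    and fS: "\<And>p. D (Suc p) * f (Suc p) = f p * D (Suc p)"
  shows "\<exists>h. (\<forall>p. h p \<in> mats (r (Suc p)) (r p)) \<and> f 0 = D 1 * h 0 \<and>
    (\<forall>p. f (Suc p) = D (Suc (Suc p)) * h (Suc p) + h p * D (Suc p))"
proof -
  note DS = resolution_mats_Suc[OF res]
  define P where "P p H \<longleftrightarrow> H \<in> mats (r (Suc p)) (r p) \<and> (p = 0 \<longrightarrow> f 0 = D 1 * H) \<and>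
    f p * D (Suc p) = D (Suc p) * (H * D (Suc p))" for p H
  obtain H0 where H0: "H0 \<in> mats (r 1) (r 0)" "D 1 * H0 = f 0"
    using resolution_lift[OF res f[of 0]] f0 by auto
  have "f 0 * D 1 = D 1 * (H0 * D 1)"
    using assoc_mult_mat[OF matsD[OF DS] matsD matsD[OF DS], of H0 0 0] H0 by simp
  then have P0: "P 0 H0" using H0 by (simp add: P_def)
  have "\<exists>h. \<forall>p. P p (h p) \<and> f (Suc p) = D (Suc (Suc p)) * h (Suc p) + h p * D (Suc p)"
  proof (rule dependent_nat_choice)
    show "\<exists>H. P 0 H" using P0 by blast
    fix H p assume PH: "P p H"
    then have H: "H \<in> mats (r (Suc p)) (r p)" by (simp add: P_def)
    have HD: "H * D (Suc p) \<in> mats (r (Suc p)) (r (Suc p))" by (rule mats_mult[OF H DS])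
    let ?B = "f (Suc p) - H * D (Suc p)"
    have B: "?B \<in> mats (r (Suc p)) (r (Suc p))" by (rule mats_minus[OF f HD])
    have "D (Suc p) * ?B = D (Suc p) * f (Suc p) - D (Suc p) * (H * D (Suc p))"
      by (rule mult_minus_distrib_mat[OF matsD[OF DS] matsD[OF f] matsD[OF HD]])
    also have "\<dots> = 0\<^sub>m (r p) (r (Suc p))"
      using PH minus_r_inv_mat[OF matsD[OF mats_mult[OF DS HD]]] by (simp add: P_def fS)
    finally obtain G where G: "G \<in> mats (r (Suc (Suc p))) (r (Suc p))" "D (Suc (Suc p)) * G = ?B"
      using resolution_lift[OF res B] by auto
    have 1: "f (Suc p) = D (Suc (Suc p)) * G + H * D (Suc p)"
      unfolding G(2) using matsD[OF f[of "Suc p"]] matsD[OF HD] by (intro eq_matI) auto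
    let ?D = "D (Suc (Suc p))"
    have "f (Suc p) * ?D = ?D * G * ?D + H * D (Suc p) * ?D"
      unfolding 1 by (rule add_mult_distrib_mat[OF matsD[OF mats_mult[OF DS G(1)]] matsD[OF HD] matsD[OF DS]])
    also have "H * D (Suc p) * ?D = H * (D (Suc p) * ?D)"
      by (rule assoc_mult_mat[OF matsD[OF H] matsD[OF DS] matsD[OF DS]])
    also have "\<dots> = 0\<^sub>m (r (Suc p)) (r (Suc (Suc p)))"
      using resolution_complex[OF res, of "Suc p"] matsD[OF H] by simp
    also have "?D * G * ?D = ?D * (G * ?D)"
      by (rule assoc_mult_mat[OF matsD[OF DS] matsD[OF G(1)] matsD[OF DS]])
    finally have "f (Suc p) * ?D = ?D * (G * ?D)"
      using matsD[OF mats_mult[OF DS mats_mult[OF G(1) DS[of "Suc p"]]]] by simp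
    with G(1) have "P (Suc p) G" by (simp add: P_def)
    with 1 show "\<exists>G. P (Suc p) G \<and> f (Suc p) = D (Suc (Suc p)) * G + H * D (Suc p)" by blast
  qed
  then obtain h where "\<And>p. P p (h p)" "\<And>p. f (Suc p) = D (Suc (Suc p)) * h (Suc p) + h p * D (Suc p)"
    by blast
  then show ?thesis by (intro exI[of _ h]) (auto simp: P_def)
qed

text \<open>The chain map \<open>g * f - 1\<close> is zero on the resolved ideal, so it is null-homotopic.\<close>

lemma homotopy_inverse:
  assumes rD: "resolution I r D" and rE: "resolution I s E"
    and f: "\<And>p. f p \<in> mats (s p) (r p)" "E 0 * f 0 = D 0"
      "\<And>p. E (Suc p) * f (Suc p) = f p * D (Suc p)"
    and g: "\<And>p. g p \<in> mats (r p) (s p)" "D 0 * g 0 = E 0"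
      "\<And>p. D (Suc p) * g (Suc p) = g p * E (Suc p)"
  shows "\<exists>h. (\<forall>p. h p \<in> mats (r (Suc p)) (r p)) \<and> g 0 * f 0 = 1\<^sub>m (r 0) + D 1 * h 0 \<and>
    (\<forall>p. g (Suc p) * f (Suc p) = 1\<^sub>m (r (Suc p)) + (D (Suc (Suc p)) * h (Suc p) + h p * D (Suc p)))"
proof -
  note DS = resolution_mats_Suc[OF rD] and ES = resolution_mats_Suc[OF rE]
  note D0 = resolution_mats_0[OF rD]
  have gf: "g p * f p \<in> mats (r p) (r p)" for p by (rule mats_mult[OF g(1) f(1)])
  let ?k = "\<lambda>p. g p * f p - 1\<^sub>m (r p)"
  have "\<exists>h. (\<forall>p. h p \<in> mats (r (Suc p)) (r p)) \<and> ?k 0 = D 1 * h 0 \<and>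
    (\<forall>p. ?k (Suc p) = D (Suc (Suc p)) * h (Suc p) + h p * D (Suc p))"
  proof (rule null_homotopy[OF rD])
    show "?k p \<in> mats (r p) (r p)" for p by (rule mats_minus[OF gf mats_one])
    have "D 0 * ?k 0 = D 0 * (g 0 * f 0) - D 0 * 1\<^sub>m (r 0)"
      by (rule mult_minus_distrib_mat[OF matsD[OF D0] matsD[OF gf]]) simp
    also have "D 0 * (g 0 * f 0) = D 0"
      using assoc_mult_mat[OF matsD[OF D0] matsD[OF g(1)] matsD[OF f(1)]] by (simp add: g(2) f(2))
    finally show "D 0 * ?k 0 = 0\<^sub>m 1 (r 0)" using matsD[OF D0] minus_r_inv_mat[OF matsD[OF D0]] by simp
    fix p
    have "D (Suc p) * (g (Suc p) * f (Suc p)) = D (Suc p) * g (Suc p) * f (Suc p)"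
      using assoc_mult_mat[OF matsD[OF DS] matsD[OF g(1)] matsD[OF f(1)]] by simp
    also have "\<dots> = g p * (E (Suc p) * f (Suc p))"
      unfolding g(3) by (rule assoc_mult_mat[OF matsD[OF g(1)] matsD[OF ES] matsD[OF f(1)]])
    also have "\<dots> = g p * f p * D (Suc p)"
      unfolding f(3) using assoc_mult_mat[OF matsD[OF g(1)] matsD[OF f(1)] matsD[OF DS]] by simp
    finally have 1: "D (Suc p) * (g (Suc p) * f (Suc p)) = g p * f p * D (Suc p)" .
    have "D (Suc p) * ?k (Suc p) = D (Suc p) * (g (Suc p) * f (Suc p)) - D (Suc p) * 1\<^sub>m (r (Suc p))"
      by (rule mult_minus_distrib_mat[OF matsD[OF DS] matsD[OF gf]]) simp
    also have "\<dots> = g p * f p * D (Suc p) - 1\<^sub>m (r p) * D (Suc p)"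
      using matsD[OF DS[of p]] by (simp add: 1)
    also have "\<dots> = ?k p * D (Suc p)"
      using minus_mult_distrib_mat[OF matsD[OF gf] _ matsD[OF DS], of "1\<^sub>m (r p)" p] by simp
    finally show "D (Suc p) * ?k (Suc p) = ?k p * D (Suc p)" .
  qed
  then obtain h where h: "\<And>p. h p \<in> mats (r (Suc p)) (r p)" and h0: "?k 0 = D 1 * h 0"
    and hS: "\<And>p. ?k (Suc p) = D (Suc (Suc p)) * h (Suc p) + h p * D (Suc p)" by blast
  have eq: "g p * f p = 1\<^sub>m (r p) + ?k p" for p
    using matsD[OF gf[of p]] by (intro eq_matI) auto
  show ?thesis
    using h eq[of 0, unfolded h0] eq[of "Suc p" for p, unfolded hS] by blast
qed

lemma vec_first_vecs: "v \<in> vecs (n + m) \<Longrightarrow> vec_first v n \<in> vecs n"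
  by (auto simp: vecs_def vec_first_def)

lemma vec_last_vecs: "v \<in> vecs (n + m) \<Longrightarrow> vec_last v m \<in> vecs m"
  by (auto simp: vecs_def vec_last_def)

text \<open>Exactness of the total complex of a two-step filtration: the subcomplex (\<open>D\<close>, \<open>D'\<close>) is exact
by \<open>ex\<close>. The premise \<open>key\<close> is exactness of the quotient complex (\<open>E\<close>, \<open>E'\<close>) for those \<open>b\<close>
that occur in a cycle of the total complex. This weaker form also covers the bottom of the resolution, where the quotient
complex is a resolution of a cyclic module and its last matrix has no rows.\<close>

lemma block_exact:
  assumes D: "D \<in> mats n m" and D': "D' \<in> mats m l"
    and ex: "(\<lambda>v. D' *\<^sub>v v) ` vecs l = mat_kernel D \<inter> vecs m"
    and B: "B \<in> mats n m2" and E: "E \<in> mats n2 m2" and B': "B' \<in> mats m l2" and E': "E' \<in> mats m2 l2"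
    and DB: "D * B' + B * E' = 0\<^sub>m n l2" and EE: "E * E' = 0\<^sub>m n2 l2"
    and key: "\<And>a b. a \<in> vecs m \<Longrightarrow> b \<in> vecs m2 \<Longrightarrow> E *\<^sub>v b = 0\<^sub>v n2 \<Longrightarrow>
      D *\<^sub>v a + B *\<^sub>v b = 0\<^sub>v n \<Longrightarrow> \<exists>e\<in>vecs l2. E' *\<^sub>v e = b"
  shows "(\<lambda>v. four_block_mat D' B' (0\<^sub>m m2 l) E' *\<^sub>v v) ` vecs (l + l2) =
    mat_kernel (four_block_mat D B (0\<^sub>m n2 m) E) \<inter> vecs (m + m2)"
proof -
  let ?M = "four_block_mat D B (0\<^sub>m n2 m) E" and ?N = "four_block_mat D' B' (0\<^sub>m m2 l) E'"
  note c = matsD[OF D] matsD[OF D'] matsD[OF B] matsD[OF E] matsD[OF B'] matsD[OF E']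
  have M: "?M \<in> mats (n + n2) (m + m2)" by (rule mats_four_block[OF D B mats_zero E])
  have N: "?N \<in> mats (m + m2) (l + l2)" by (rule mats_four_block[OF D' B' mats_zero E'])
  have Mv: "?M *\<^sub>v (a @\<^sub>v b) = (D *\<^sub>v a + B *\<^sub>v b) @\<^sub>v (E *\<^sub>v b)"
    if "a \<in> vecs m" "b \<in> vecs m2" for a b
    using that c by (subst four_block_mat_mult_vec[of D n m B m2 _ n2])
      (auto simp: vecsD zero_mat_mult_vec)
  have Nv: "?N *\<^sub>v (a @\<^sub>v b) = (D' *\<^sub>v a + B' *\<^sub>v b) @\<^sub>v (E' *\<^sub>v b)"
    if "a \<in> vecs l" "b \<in> vecs l2" for a b
    using that c by (subst four_block_mat_mult_vec[of D' m l B' l2 _ m2])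
      (auto simp: vecsD zero_mat_mult_vec)
  have DD: "D *\<^sub>v (D' *\<^sub>v a) = 0\<^sub>v n" if "a \<in> vecs l" for a
    using ex that mat_kernelD[OF matsD[OF D]] by blast
  have DB': "D *\<^sub>v (B' *\<^sub>v b) + B *\<^sub>v (E' *\<^sub>v b) = 0\<^sub>v n" if "b \<in> vecs l2" for b
  proof -
    have "D *\<^sub>v (B' *\<^sub>v b) + B *\<^sub>v (E' *\<^sub>v b) = (D * B') *\<^sub>v b + (B * E') *\<^sub>v b"
      using c vecsD[OF that] by simp
    also have "\<dots> = (D * B' + B * E') *\<^sub>v b"
      using c vecsD[OF that] by (subst add_mult_distrib_mat_vec[of _ n l2]) auto
    finally show ?thesis using vecsD[OF that] by (simp add: DB zero_mat_mult_vec)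
  qed
  have EE': "E *\<^sub>v (E' *\<^sub>v b) = 0\<^sub>v n2" if "b \<in> vecs l2" for b
  proof -
    have "E *\<^sub>v (E' *\<^sub>v b) = (E * E') *\<^sub>v b" using c vecsD[OF that] by simp
    then show ?thesis using vecsD[OF that] by (simp add: EE zero_mat_mult_vec)
  qed
  show ?thesis
  proof (intro equalityI subsetI)
    fix w assume "w \<in> (\<lambda>v. ?N *\<^sub>v v) ` vecs (l + l2)"
    then obtain v where v: "v \<in> vecs (l + l2)" and w: "w = ?N *\<^sub>v v" by blast
    define a b where "a = vec_first v l" and "b = vec_last v l2"
    have ab: "a \<in> vecs l" "b \<in> vecs l2" "v = a @\<^sub>v b"
      using vec_first_vecs[OF v] vec_last_vecs[OF v] vecsD[OF v] by (simp_all add: a_def b_def)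
    have wv: "w \<in> vecs (m + m2)" unfolding w by (rule mats_mult_vec[OF N v])
    have 1: "D' *\<^sub>v a + B' *\<^sub>v b \<in> vecs m" "E' *\<^sub>v b \<in> vecs m2"
      using vecs_add[OF mats_mult_vec[OF D' ab(1)] mats_mult_vec[OF B' ab(2)]]
        mats_mult_vec[OF E' ab(2)] by simp_all
    have "D *\<^sub>v (D' *\<^sub>v a + B' *\<^sub>v b) = D *\<^sub>v (D' *\<^sub>v a) + D *\<^sub>v (B' *\<^sub>v b)"
      using c vecsD[OF ab(1)] vecsD[OF ab(2)] by (intro mult_add_distrib_mat_vec) auto
    also have "\<dots> = D *\<^sub>v (B' *\<^sub>v b)" using DD[OF ab(1)] c vecsD[OF ab(2)] by simp
    finally have 2: "D *\<^sub>v (D' *\<^sub>v a + B' *\<^sub>v b) + B *\<^sub>v (E' *\<^sub>v b) = 0\<^sub>v n"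
      using DB'[OF ab(2)] by simp
    have "?M *\<^sub>v w = 0\<^sub>v n @\<^sub>v 0\<^sub>v n2"
      unfolding w ab(3) Nv[OF ab(1,2)] Mv[OF 1] 2 EE'[OF ab(2)] ..
    then have "?M *\<^sub>v w = 0\<^sub>v (n + n2)" by (auto intro!: eq_vecI)
    with wv show "w \<in> mat_kernel ?M \<inter> vecs (m + m2)"
      using mat_kernelI[OF matsD[OF M] vecsD[OF wv]] by blast
  next
    fix w assume "w \<in> mat_kernel ?M \<inter> vecs (m + m2)"
    then have w: "w \<in> vecs (m + m2)" and Mw: "?M *\<^sub>v w = 0\<^sub>v (n + n2)"
      using mat_kernelD[OF matsD[OF M]] by auto
    define a b where "a = vec_first w m" and "b = vec_last w m2"
    have ab: "a \<in> vecs m" "b \<in> vecs m2" "w = a @\<^sub>v b"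
      using vec_first_vecs[OF w] vec_last_vecs[OF w] vecsD[OF w] by (simp_all add: a_def b_def)
    have "(D *\<^sub>v a + B *\<^sub>v b) @\<^sub>v (E *\<^sub>v b) = 0\<^sub>v n @\<^sub>v 0\<^sub>v n2"
      using Mw unfolding ab(3) Mv[OF ab(1,2)] by (auto intro!: eq_vecI)
    moreover have "D *\<^sub>v a + B *\<^sub>v b \<in> carrier_vec n"
      using vecsD[OF vecs_add[OF mats_mult_vec[OF D ab(1)] mats_mult_vec[OF B ab(2)]]] .
    ultimately have "D *\<^sub>v a + B *\<^sub>v b = 0\<^sub>v n \<and> E *\<^sub>v b = 0\<^sub>v n2"
      by (rule iffD1[OF append_vec_eq, rotated 2]) simp
    then have z: "D *\<^sub>v a + B *\<^sub>v b = 0\<^sub>v n" "E *\<^sub>v b = 0\<^sub>v n2" by blast+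
    from key[OF ab(1,2) z(2,1)] obtain e where e: "e \<in> vecs l2" "E' *\<^sub>v e = b" by blast
    have B'e: "B' *\<^sub>v e \<in> vecs m" by (rule mats_mult_vec[OF B' e(1)])
    have ae: "a - B' *\<^sub>v e \<in> vecs m" by (rule vecs_minus[OF ab(1) B'e])
    have "D *\<^sub>v (a - B' *\<^sub>v e) = D *\<^sub>v a - D *\<^sub>v (B' *\<^sub>v e)"
      by (rule mult_minus_distrib_mat_vec[OF matsD[OF D] vecsD[OF ab(1)] vecsD[OF B'e]])
    also have "\<dots> = 0\<^sub>v n"
    proof (rule eq_vecI)
      fix i assume "i < dim_vec (0\<^sub>v n)"
      then have i: "i < n" by simp
      have "(D *\<^sub>v a + B *\<^sub>v b) $ i = 0" "(D *\<^sub>v (B' *\<^sub>v e) + B *\<^sub>v b) $ i = 0"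
        using z(1) DB'[OF e(1)] i by (simp_all add: e(2))
      then show "(D *\<^sub>v a - D *\<^sub>v (B' *\<^sub>v e)) $ i = 0\<^sub>v n $ i"
        using i c by (simp add: add_eq_0_iff2)
    qed (use c in auto)
    finally have "a - B' *\<^sub>v e \<in> mat_kernel D \<inter> vecs m"
      using ae mat_kernelI[OF matsD[OF D] vecsD[OF ae]] by blast
    then have "a - B' *\<^sub>v e \<in> (\<lambda>v. D' *\<^sub>v v) ` vecs l" unfolding ex .
    then obtain a' where a': "a' \<in> vecs l" "D' *\<^sub>v a' = a - B' *\<^sub>v e" by auto
    have "D' *\<^sub>v a' + B' *\<^sub>v e = a"
      unfolding a'(2) using vecsD[OF ab(1)] carrier_matD(1)[OF matsD[OF B']]
      by (intro eq_vecI) auto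
    then have "?N *\<^sub>v (a' @\<^sub>v e) = w" unfolding Nv[OF a'(1) e(1)] e(2) ab(3) by simp
    then show "w \<in> (\<lambda>v. ?N *\<^sub>v v) ` vecs (l + l2)"
      using vecs_append[OF a'(1) e(1)] by blast
  qed
qed

text \<open>The ranks of the resolution of \<open>I + (c)\<close> glued from resolutions of \<open>I\<close> and of the colon
ideal of \<open>I\<close> by \<open>c\<close>. The latter, extended by the ring itself in degree 0, resolves \<open>(I + (c)) / I\<close>,
hence the shift in \<open>target_rank s\<close>.\<close>

definition extend_ranks :: "(nat \<Rightarrow> nat) \<Rightarrow> (nat \<Rightarrow> nat) \<Rightarrow> nat \<Rightarrow> nat" where
  "extend_ranks r s p = r p + target_rank s p"

text \<open>The sign of \<open>E\<close> turns the commuting squares of the chain map \<open>f\<close> into the vanishing of the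
product of consecutive matrices. For \<open>p = 0\<close> the lower blocks have no rows, and the matrix is the row of
\<open>D 0\<close> followed by \<open>c\<close>.\<close>

definition extend_mats ::
  "'a \<Rightarrow> (nat \<Rightarrow> nat) \<Rightarrow> (nat \<Rightarrow> 'a mat) \<Rightarrow> (nat \<Rightarrow> nat) \<Rightarrow> (nat \<Rightarrow> 'a mat) \<Rightarrow> (nat \<Rightarrow> 'a mat) \<Rightarrow> nat \<Rightarrow> 'a mat"
  where
  "extend_mats c r D s E f p = (case p of
     0 \<Rightarrow> four_block_mat (D 0) (mat 1 1 (\<lambda>_. c)) (0\<^sub>m 0 (r 0)) (0\<^sub>m 0 1)
   | Suc q \<Rightarrow> four_block_mat (D (Suc q)) (f q) (0\<^sub>m (target_rank s q) (r (Suc q))) (- E q))"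

lemma resolution_extend:
  assumes rD: "resolution I r D" and rE: "resolution J s E" and c: "c \<in> R"
    and J: "J = {x \<in> R. c * x \<in> I}"
    and f: "\<And>p. f p \<in> mats (r p) (s p)" and f0: "D 0 * f 0 = c \<cdot>\<^sub>m E 0"
    and fS: "\<And>p. D (Suc p) * f (Suc p) = f p * E (Suc p)"
  shows "resolution {x + c * y |x y. x \<in> I \<and> y \<in> R} (extend_ranks r s) (extend_mats c r D s E f)"
proof -
  note D = resolution_mats[OF rD] and D0 = resolution_mats_0[OF rD] and DS = resolution_mats_Suc[OF rD]
  note E = resolution_mats[OF rE] and E0 = resolution_mats_0[OF rE] and ES = resolution_mats_Suc[OF rE]
  let ?N = "extend_mats c r D s E f"
  have exD: "(\<lambda>v. D (Suc p) *\<^sub>v v) ` vecs (r (Suc p)) = mat_kernel (D p) \<inter> vecs (r p)" for p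
    using rD by (simp add: resolution_def)
  have exE: "(\<lambda>v. E (Suc p) *\<^sub>v v) ` vecs (s (Suc p)) = mat_kernel (E p) \<inter> vecs (s p)" for p
    using rE by (simp add: resolution_def)
  have imD: "(\<lambda>v. (D 0 *\<^sub>v v) $ 0) ` vecs (r 0) = I" using rD by (simp add: resolution_def)
  have imE: "(\<lambda>v. (E 0 *\<^sub>v v) $ 0) ` vecs (s 0) = J" using rE by (simp add: resolution_def)
  define B where "B p = (case p of 0 \<Rightarrow> mat 1 1 (\<lambda>_. c) | Suc q \<Rightarrow> f q)" for p
  define n2 where "n2 p = (case p of 0 \<Rightarrow> 0 | Suc q \<Rightarrow> target_rank s q)" for p
  \<comment> \<open>The quotient complex: the resolution of \<open>J\<close>, shifted by one, with the ring itself (rank 1) in degree 0.\<close>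
  define E' where "E' p = (case p of 0 \<Rightarrow> 0\<^sub>m 0 1 | Suc q \<Rightarrow> - E q)" for p
  have B: "B p \<in> mats (target_rank r p) (target_rank s p)" for p
    using f c by (auto simp: B_def mats_def split: nat.split)
  have E': "E' p \<in> mats (n2 p) (target_rank s p)" for p
    using mats_uminus[OF E] by (auto simp: E'_def n2_def mats_zero split: nat.split)
  have N: "?N p = four_block_mat (D p) (B p) (0\<^sub>m (n2 p) (r p)) (E' p)" for p
    by (cases p) (simp_all add: extend_mats_def B_def E'_def n2_def)
  have row: "target_rank (extend_ranks r s) p = target_rank r p + n2 p" for p
    by (cases p) (simp_all add: extend_ranks_def n2_def)
  have mats: "?N p \<in> mats (target_rank (extend_ranks r s) p) (extend_ranks r s p)" for p
    unfolding row unfolding N extend_ranks_def by (rule mats_four_block[OF D B mats_zero E'])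
  have Nv: "(?N 0 *\<^sub>v (a @\<^sub>v b)) $ 0 = (D 0 *\<^sub>v a) $ 0 + c * b $ 0"
    if "a \<in> vecs (r 0)" "b \<in> vecs 1" for a b
  proof -
    have "?N 0 *\<^sub>v (a @\<^sub>v b) = (D 0 *\<^sub>v a + mat 1 1 (\<lambda>_. c) *\<^sub>v b) @\<^sub>v (0\<^sub>m 0 (r 0) *\<^sub>v a + 0\<^sub>m 0 1 *\<^sub>v b)"
      unfolding extend_mats_def nat.case using matsD[OF D0] vecsD[OF that(1)] vecsD[OF that(2)]
      by (subst four_block_mat_mult_vec[of _ 1 "r 0" _ 1 _ 0]) auto
    then show ?thesis using matsD[OF D0] vecsD[OF that(1)] vecsD[OF that(2)]
      by (simp add: scalar_prod_def)
  qed
  have im: "(\<lambda>v. (?N 0 *\<^sub>v v) $ 0) ` vecs (extend_ranks r s 0) = {x + c * y |x y. x \<in> I \<and> y \<in> R}"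
  proof (intro equalityI subsetI)
    fix w assume "w \<in> (\<lambda>v. (?N 0 *\<^sub>v v) $ 0) ` vecs (extend_ranks r s 0)"
    then obtain v where v: "v \<in> vecs (r 0 + 1)" and w: "w = (?N 0 *\<^sub>v v) $ 0"
      by (auto simp: extend_ranks_def)
    define a b where "a = vec_first v (r 0)" and "b = vec_last v 1"
    have ab: "a \<in> vecs (r 0)" "b \<in> vecs 1" "v = a @\<^sub>v b"
      using vec_first_vecs[OF v] vec_last_vecs[OF v] vecsD[OF v] by (simp_all add: a_def b_def)
    have "(D 0 *\<^sub>v a) $ 0 \<in> I" "b $ 0 \<in> R" using ab imD by (auto simp: vecs_def)
    then show "w \<in> {x + c * y |x y. x \<in> I \<and> y \<in> R}" unfolding w ab(3) Nv[OF ab(1,2)] by blast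
  next
    fix w assume "w \<in> {x + c * y |x y. x \<in> I \<and> y \<in> R}"
    then obtain x y where xy: "x \<in> I" "y \<in> R" "w = x + c * y" by blast
    then obtain a where a: "a \<in> vecs (r 0)" "(D 0 *\<^sub>v a) $ 0 = x" using imD by auto
    have b: "vec 1 (\<lambda>_. y) \<in> vecs 1" using xy by (simp add: vecs_def)
    have "(?N 0 *\<^sub>v (a @\<^sub>v vec 1 (\<lambda>_. y))) $ 0 = w" unfolding Nv[OF a(1) b] by (simp add: a xy)
    moreover have "a @\<^sub>v vec 1 (\<lambda>_. y) \<in> vecs (extend_ranks r s 0)"
      using vecs_append[OF a(1) b] by (simp add: extend_ranks_def)
    ultimately show "w \<in> (\<lambda>v. (?N 0 *\<^sub>v v) $ 0) ` vecs (extend_ranks r s 0)" by blast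
  qed
  have DB: "D p * B (Suc p) + B p * E' (Suc p) = 0\<^sub>m (target_rank r p) (s p)" for p
  proof -
    have "D p * B (Suc p) = B p * E p"
    proof (cases p)
      case 0
      have "mat 1 1 (\<lambda>_. c) * E 0 = c \<cdot>\<^sub>m E 0"
        using matsD[OF E0] by (intro eq_matI) (auto simp: scalar_prod_def)
      then show ?thesis using 0 by (simp add: B_def f0)
    qed (simp add: B_def fS)
    moreover have "B p * E' (Suc p) = - (B p * E p)"
      using matsD[OF B[of p]] matsD[OF E[of p]] by (simp add: E'_def)
    moreover have "X + - X = 0\<^sub>m a b" if "X \<in> carrier_mat a b" for X :: "'a mat" and a b
      using that by (intro eq_matI) auto
    ultimately show ?thesis using matsD[OF mats_mult[OF B[of p] E]] by metis
  qed
  have EE: "E' p * E' (Suc p) = 0\<^sub>m (n2 p) (s p)" for p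
  proof (cases p)
    case 0
    then show ?thesis using matsD[OF E0] by (intro eq_matI) (auto simp: E'_def n2_def)
  next
    case (Suc q)
    have "- E q * - E (Suc q) = E q * E (Suc q)"
      using matsD[OF E[of q]] matsD[OF E[of "Suc q"]] by (intro eq_matI) auto
    then show ?thesis using Suc resolution_complex[OF rE, of q] by (simp add: E'_def n2_def)
  qed
  have neg: "- E p *\<^sub>v (- 1 \<cdot>\<^sub>v e) = E p *\<^sub>v e" "- 1 \<cdot>\<^sub>v e \<in> vecs (s p)" if "e \<in> vecs (s p)" for p e
    using that matsD[OF E[of p]] one_closed uminus_closed
    by (auto simp: vecs_def intro!: eq_vecI)
  have key: "\<exists>e\<in>vecs (s p). E' (Suc p) *\<^sub>v e = b"
    if ab: "a \<in> vecs (r p)" "b \<in> vecs (target_rank s p)" and Eb: "E' p *\<^sub>v b = 0\<^sub>v (n2 p)"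
      and DBab: "D p *\<^sub>v a + B p *\<^sub>v b = 0\<^sub>v (target_rank r p)" for p a b
  proof -
    have "\<exists>e\<in>vecs (s p). E p *\<^sub>v e = b"
    proof (cases p)
      case 0
      have a: "a \<in> vecs (r 0)" and b: "b \<in> vecs 1" using ab 0 by simp_all
      have "(D 0 *\<^sub>v a + mat 1 1 (\<lambda>_. c) *\<^sub>v b) $ 0 = 0" using DBab 0 by (simp add: B_def)
      then have "(D 0 *\<^sub>v a) $ 0 + c * b $ 0 = 0"
        using matsD[OF D0] vecsD[OF b] by (simp add: scalar_prod_def)
      then have "c * b $ 0 = - (D 0 *\<^sub>v a) $ 0" by (simp add: add_eq_0_iff)
      also have "\<dots> = (D 0 *\<^sub>v (- 1 \<cdot>\<^sub>v a)) $ 0"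
        using matsD[OF D0] vecsD[OF a] by simp
      also have "\<dots> \<in> I"
      proof -
        have "- 1 \<cdot>\<^sub>v a \<in> vecs (r 0)" using a one_closed uminus_closed by (auto simp: vecs_def)
        then show ?thesis using imD by blast
      qed
      finally have "b $ 0 \<in> J" using b by (simp add: J vecs_def)
      then obtain e where e: "e \<in> vecs (s 0)" "(E 0 *\<^sub>v e) $ 0 = b $ 0" using imE by auto
      have "E 0 *\<^sub>v e = b" using e(2) matsD[OF E0] vecsD[OF b] by (intro eq_vecI) auto
      with e(1) 0 show ?thesis by blast
    next
      case (Suc q)
      have b: "b \<in> vecs (s q)" using ab Suc by simp
      have "E q *\<^sub>v b = - (- E q *\<^sub>v b)"
        using matsD[OF E[of q]] vecsD[OF b] by (intro eq_vecI) auto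
      also have "\<dots> = 0\<^sub>v (target_rank s q)" using Eb Suc by (simp add: E'_def n2_def)
      finally have "b \<in> mat_kernel (E q) \<inter> vecs (s q)"
        using mat_kernelI[OF matsD[OF E] vecsD[OF b]] b by blast
      then have "b \<in> (\<lambda>v. E p *\<^sub>v v) ` vecs (s p)" unfolding Suc exE .
      then show ?thesis by blast
    qed
    then obtain e where "e \<in> vecs (s p)" "E p *\<^sub>v e = b" by blast
    with neg[of e p] show ?thesis unfolding E'_def nat.case by blast
  qed
  have ex: "(\<lambda>v. ?N (Suc p) *\<^sub>v v) ` vecs (extend_ranks r s (Suc p)) =
    mat_kernel (?N p) \<inter> vecs (extend_ranks r s p)" for p
  proof -
    have n2S: "n2 (Suc p) = target_rank s p" by (simp add: n2_def)
    have B': "B (Suc p) \<in> mats (r p) (s p)" using B[of "Suc p"] by simp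
    have E'': "E' (Suc p) \<in> mats (target_rank s p) (s p)" using E'[of "Suc p"] by (simp add: n2S)
    show ?thesis
      unfolding N n2S extend_ranks_def nat.case
      by (rule block_exact[OF D DS exD B E' B' E'' DB EE key])
  qed
  show ?thesis unfolding resolution_def using mats im ex by blast
qed

lemma resolution_entry:
  assumes "resolution I r D" "j < r 0"
  shows "D 0 $$ (0, j) \<in> I"
proof -
  have u: "unit_vec (r 0) j \<in> vecs (r 0)"
    by (auto simp: vecs_def unit_vec_def zero_closed one_closed)
  have "(D 0 *\<^sub>v unit_vec (r 0) j) $ 0 = D 0 $$ (0, j)"
    using matsD[OF resolution_mats_0[OF assms(1)]] assms(2) by simp
  moreover have "(D 0 *\<^sub>v unit_vec (r 0) j) $ 0 \<in> I"
    using u assms(1) by (auto simp: resolution_def)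
  ultimately show ?thesis by simp
qed

text \<open>After applying \<open>\<epsilon>\<close>, the homotopy equivalence between the two resolutions has target a complex
with zero differentials, whose homology in degree \<open>i\<close> has dimension \<open>s i\<close>. Stated as a sum
instead of a difference, the conclusion also records that the subtraction in \<open>tor_dim\<close> does not truncate.\<close>

lemma kernel_dim_tensored_resolution:
  fixes \<epsilon> :: "'a \<Rightarrow> 'k::field" and T :: "nat \<Rightarrow> 'k mat"
  assumes hom: "comm_ring_hom \<epsilon>" and rD: "resolution I r D" and rE: "resolution I s E"
    and min: "\<And>p. map_mat \<epsilon> (E (Suc p)) = 0\<^sub>m (s p) (s (Suc p))"
    and T0: "T 0 = 0\<^sub>m 0 (r 0)" and TS: "\<And>p. T (Suc p) = map_mat \<epsilon> (D (Suc p))"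
  shows "kernel_dim (T i) = s i + vec_space.rank (r i) (T (Suc i))"
proof -
  interpret \<epsilon>: comm_ring_hom \<epsilon> by (rule hom)
  note DS = resolution_mats_Suc[OF rD] and ES = resolution_mats_Suc[OF rE]
  have E0: "1 \<cdot>\<^sub>m E 0 = E 0" and D0: "1 \<cdot>\<^sub>m D 0 = D 0" by auto
  obtain f where f: "\<And>p. f p \<in> mats (s p) (r p)" "E 0 * f 0 = D 0"
      "\<And>p. E (Suc p) * f (Suc p) = f p * D (Suc p)"
    using comparison_map[OF rE resolution_mats[OF rD] resolution_complex[OF rD] one_closed]
      resolution_entry[OF rD] by (auto simp: D0)
  obtain g where g: "\<And>p. g p \<in> mats (r p) (s p)" "D 0 * g 0 = E 0"
      "\<And>p. D (Suc p) * g (Suc p) = g p * E (Suc p)"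
    using comparison_map[OF rD resolution_mats[OF rE] resolution_complex[OF rE] one_closed]
      resolution_entry[OF rE] by (auto simp: E0)
  obtain h where h: "\<And>p. h p \<in> mats (r (Suc p)) (r p)" "g 0 * f 0 = 1\<^sub>m (r 0) + D 1 * h 0"
    "\<And>p. g (Suc p) * f (Suc p) = 1\<^sub>m (r (Suc p)) + (D (Suc (Suc p)) * h (Suc p) + h p * D (Suc p))"
    using homotopy_inverse[OF rD rE f g] by blast
  obtain k where k: "\<And>p. k p \<in> mats (s (Suc p)) (s p)" "f 0 * g 0 = 1\<^sub>m (s 0) + E 1 * k 0"
    "\<And>p. f (Suc p) * g (Suc p) = 1\<^sub>m (s (Suc p)) + (E (Suc (Suc p)) * k (Suc p) + k p * E (Suc p))"
    using homotopy_inverse[OF rE rD g f] by blast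
  let ?M = "map_mat \<epsilon>"
  have Mc: "?M A \<in> carrier_mat n m" if "A \<in> mats n m" for A n m using matsD[OF that] by simp
  have Mmult: "?M (A * B) = ?M A * ?M B" if "A \<in> mats n m" "B \<in> mats m l" for A B n m l
    by (rule \<epsilon>.mat_hom_mult[OF matsD[OF that(1)] matsD[OF that(2)]])
  have Madd: "?M (A + B) = ?M A + ?M B" if "A \<in> mats n m" "B \<in> mats n m" for A B n m
    using matsD[OF that(1)] matsD[OF that(2)] by (intro eq_matI) (auto simp: \<epsilon>.hom_add)
  have M0: "?M (0\<^sub>m n m) = 0\<^sub>m n m" for n m by (intro eq_matI) auto
  have fg: "?M (f p) * ?M (g p) = 1\<^sub>m (s p)" for p
  proof (cases p)
    case 0
    have "?M (f 0) * ?M (g 0) = ?M (f 0 * g 0)" by (rule Mmult[OF f(1) g(1), symmetric])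
    also have "\<dots> = 1\<^sub>m (s 0) + ?M (E (Suc 0)) * ?M (k 0)"
      using Madd[OF mats_one mats_mult[OF ES k(1)], of 0] Mmult[OF ES k(1), of 0]
      by (simp add: k(2) \<epsilon>.mat_hom_one)
    finally show ?thesis using Mc[OF k(1)[of 0]] by (simp add: min 0)
  next
    case (Suc q)
    have "?M (f p) * ?M (g p) = ?M (f p * g p)" by (rule Mmult[OF f(1) g(1), symmetric])
    also have "\<dots> = 1\<^sub>m (s p) + (?M (E (Suc p)) * ?M (k p) + ?M (k q) * ?M (E p))"
      unfolding Suc k(3) using Madd[OF mats_one mats_add[OF mats_mult[OF ES k(1)] mats_mult[OF k(1) ES]], of q]
        Madd[OF mats_mult[OF ES k(1)] mats_mult[OF k(1) ES], of q] Mmult[OF ES k(1), of "Suc q"] Mmult[OF k(1) ES, of q]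
      by (simp add: \<epsilon>.mat_hom_one)
    also have "\<dots> = 1\<^sub>m (s p)"
      using Mc[OF k(1)[of p]] Mc[OF k(1)[of q]] by (simp add: min Suc)
    finally show ?thesis .
  qed
  have fB: "?M (f p) * ?M (D (Suc p)) = 0\<^sub>m (s p) (r (Suc p))" for p
  proof -
    have "?M (f p) * ?M (D (Suc p)) = ?M (E (Suc p) * f (Suc p))"
      unfolding f(3) by (rule Mmult[OF f(1) DS, symmetric])
    also have "\<dots> = ?M (E (Suc p)) * ?M (f (Suc p))" by (rule Mmult[OF ES f(1)])
    finally show ?thesis using Mc[OF f(1)[of "Suc p"]] by (simp add: min)
  qed
  have Dg: "?M (D (Suc p)) * ?M (g (Suc p)) = 0\<^sub>m (r p) (s (Suc p))" for p
  proof -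
    have "?M (D (Suc p)) * ?M (g (Suc p)) = ?M (g p * E (Suc p))"
      unfolding g(3)[symmetric] by (rule Mmult[OF DS g(1), symmetric])
    also have "\<dots> = ?M (g p) * ?M (E (Suc p))" by (rule Mmult[OF g(1) ES])
    finally show ?thesis using Mc[OF g(1)[of p]] by (simp add: min)
  qed
  show ?thesis
  proof (cases i)
    case 0
    show ?thesis unfolding 0 T0 TS
    proof (rule kernel_dim_eq_add_rank[OF zero_carrier_mat Mc[OF DS] Mc[OF f(1)] Mc[OF g(1)] Mc[OF h(1)] zero_carrier_mat _ _ fB fg])
      show "0\<^sub>m 0 (r 0) * ?M (D (Suc 0)) = 0\<^sub>m 0 (r (Suc 0))" using Mc[OF DS[of 0]] by simp
      show "0\<^sub>m 0 (r 0) * ?M (g 0) = 0\<^sub>m 0 (s 0)" using Mc[OF g(1)[of 0]] by simp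
      have "?M (g 0) * ?M (f 0) = ?M (g 0 * f 0)" by (rule Mmult[OF g(1) f(1), symmetric])
      also have "\<dots> = 1\<^sub>m (r 0) + ?M (D (Suc 0)) * ?M (h 0)"
        using Madd[OF mats_one mats_mult[OF DS h(1)], of 0] Mmult[OF DS h(1), of 0]
        by (simp add: h(2) \<epsilon>.mat_hom_one)
      finally show "?M (g 0) * ?M (f 0) = 1\<^sub>m (r 0) + (?M (D (Suc 0)) * ?M (h 0) + 0\<^sub>m (r 0) 0 * 0\<^sub>m 0 (r 0))"
        using Mc[OF mats_mult[OF DS h(1)], of 0] by (simp add: Mmult[OF DS h(1)])
    qed
  next
    case (Suc q)
    show ?thesis unfolding Suc TS
    proof (rule kernel_dim_eq_add_rank[OF Mc[OF DS] Mc[OF DS] Mc[OF f(1)] Mc[OF g(1)] Mc[OF h(1)] Mc[OF h(1)] _ Dg fB fg])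
      show "?M (D (Suc q)) * ?M (D (Suc (Suc q))) = 0\<^sub>m (r q) (r (Suc (Suc q)))"
        using Mmult[OF DS DS, of q] resolution_complex[OF rD, of "Suc q"] by (simp add: M0)
      have "?M (g (Suc q)) * ?M (f (Suc q)) = ?M (g (Suc q) * f (Suc q))" by (rule Mmult[OF g(1) f(1), symmetric])
      also have "\<dots> = 1\<^sub>m (r (Suc q)) + (?M (D (Suc (Suc q))) * ?M (h (Suc q)) + ?M (h q) * ?M (D (Suc q)))"
        unfolding h(3) using Madd[OF mats_one mats_add[OF mats_mult[OF DS h(1)] mats_mult[OF h(1) DS]], of q]
          Madd[OF mats_mult[OF DS h(1)] mats_mult[OF h(1) DS], of q] Mmult[OF DS h(1), of "Suc q"] Mmult[OF h(1) DS, of q]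
        by (simp add: \<epsilon>.mat_hom_one)
      finally show "?M (g (Suc q)) * ?M (f (Suc q)) =
        1\<^sub>m (r (Suc q)) + (?M (D (Suc (Suc q))) * ?M (h (Suc q)) + ?M (h q) * ?M (D (Suc q)))" .
    qed
  qed
qed

end

section \<open>Monomials\<close>

definition total_degree :: "('v \<Rightarrow>\<^sub>0 nat) \<Rightarrow> nat" where
  "total_degree m = sum (Poly_Mapping.lookup m) (Poly_Mapping.keys m)"

text \<open>Pointwise, since the library's order on finitely supported functions is lexicographic.\<close>

definition monomial_dvd :: "('v \<Rightarrow>\<^sub>0 nat) \<Rightarrow> ('v \<Rightarrow>\<^sub>0 nat) \<Rightarrow> bool" where
  "monomial_dvd g m \<longleftrightarrow> (\<forall>v. Poly_Mapping.lookup g v \<le> Poly_Mapping.lookup m v)"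

lemma total_degree_superset:
  "finite S \<Longrightarrow> Poly_Mapping.keys m \<subseteq> S \<Longrightarrow> total_degree m = sum (Poly_Mapping.lookup m) S"
  unfolding total_degree_def by (rule sum.mono_neutral_left) (auto simp: in_keys_iff)

lemma total_degree_add: "total_degree (m + n) = total_degree m + total_degree n"
  using total_degree_superset[of "Poly_Mapping.keys m \<union> Poly_Mapping.keys n"] Poly_Mapping.keys_add[of m n]
  by (simp add: lookup_add sum.distrib)

lemma total_degree_zero: "total_degree 0 = 0"
  by (simp add: total_degree_def)

lemma total_degree_single: "total_degree (Poly_Mapping.single v n) = n"
  by (simp add: total_degree_def)

lemma total_degree_sum: "total_degree (sum f S) = (\<Sum>x\<in>S. total_degree (f x))"
  by (induct S rule: infinite_finite_induct) (simp_all add: total_degree_zero total_degree_add)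

lemma monomial_dvd_refl: "monomial_dvd m m"
  by (simp add: monomial_dvd_def)

lemma monomial_dvd_trans: "monomial_dvd a b \<Longrightarrow> monomial_dvd b c \<Longrightarrow> monomial_dvd a c"
  unfolding monomial_dvd_def by (blast intro: order_trans)

lemma monomial_dvd_add_right: "monomial_dvd m (n + m)"
  by (simp add: monomial_dvd_def lookup_add)

lemma monomial_dvd_imp_add: "monomial_dvd g m \<Longrightarrow> m = (m - g) + g"
  by (rule poly_mapping_eqI) (simp add: monomial_dvd_def lookup_add lookup_minus)

lemma monomial_dvd_add_mono: "monomial_dvd a b \<Longrightarrow> monomial_dvd (c + a) (c + b)"
  by (simp add: monomial_dvd_def lookup_add)

lemma monomial_dvd_total_degree_eq: "monomial_dvd g m \<Longrightarrow> total_degree g = total_degree m \<Longrightarrow> g = m"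
proof -
  assume g: "monomial_dvd g m" "total_degree g = total_degree m"
  have "total_degree (m - g) = 0" using g(2) total_degree_add[of "m - g" g] monomial_dvd_imp_add[OF g(1)] by simp
  then have "m - g = 0"
    by (auto simp: total_degree_def in_keys_iff intro!: poly_mapping_eqI)
  then show "g = m" using monomial_dvd_imp_add[OF g(1)] by simp
qed

lemma monomial_dvd_single_iff: "monomial_dvd (Poly_Mapping.single v 1) m \<longleftrightarrow> v \<in> Poly_Mapping.keys m"
  by (auto simp: monomial_dvd_def in_keys_iff lookup_single when_def)

section \<open>Polynomials\<close>

lemma keys_poly_add: "m \<in> Poly_Mapping.keys (f + g) \<Longrightarrow> m \<in> Poly_Mapping.keys f \<or> m \<in> Poly_Mapping.keys g"
  using subsetD[OF Poly_Mapping.keys_add[of f g]] by blast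

lemma keys_poly_mult: "m \<in> Poly_Mapping.keys (f * g) \<Longrightarrow>
    \<exists>a\<in>Poly_Mapping.keys f. \<exists>b\<in>Poly_Mapping.keys g. m = a + b"
  using subsetD[OF Poly_Mapping.keys_mult[of f g]] by blast

lemma poly_ring_carrier:
  "f \<in> carrier (poly_ring V) \<longleftrightarrow> (\<forall>m\<in>Poly_Mapping.keys f. Poly_Mapping.keys m \<subseteq> V)"
  by (simp add: poly_ring_def)

interpretation poly: scalar_subring "carrier (poly_ring V :: ('v, 'k::field) mpoly ring)" for V :: "'v set"
proof
  fix f g :: "('v, 'k) mpoly"
  assume f: "f \<in> carrier (poly_ring V)"
  show "- f \<in> carrier (poly_ring V)"
    using f by (simp add: poly_ring_carrier in_keys_iff)
  assume g: "g \<in> carrier (poly_ring V)"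
  show "f + g \<in> carrier (poly_ring V)"
    using f g unfolding poly_ring_carrier by (meson keys_poly_add)
  show "f * g \<in> carrier (poly_ring V)"
    unfolding poly_ring_carrier
  proof
    fix m assume "m \<in> Poly_Mapping.keys (f * g)"
    from keys_poly_mult[OF this] obtain a b where "a \<in> Poly_Mapping.keys f" "b \<in> Poly_Mapping.keys g"
      "m = a + b" by blast
    moreover from this have "Poly_Mapping.keys a \<subseteq> V" "Poly_Mapping.keys b \<subseteq> V"
      using f g by (simp_all add: poly_ring_carrier)
    ultimately show "Poly_Mapping.keys m \<subseteq> V" using Poly_Mapping.keys_add[of a b] by blast
  qed
qed (auto simp: poly_ring_carrier)

lemma comm_ring_hom_constant_term:
  "comm_ring_hom (\<lambda>f :: ('v, 'k::field) mpoly. Poly_Mapping.lookup f 0)"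
proof
  fix f g :: "('v, 'k) mpoly"
  have eq: "(0 = l + q) \<longleftrightarrow> l = 0 \<and> q = 0" for l q :: "'v \<Rightarrow>\<^sub>0 nat"
    by (auto simp: poly_mapping_eq_iff fun_eq_iff lookup_add)
  have "Poly_Mapping.lookup (f * g) 0 =
      (\<Sum>l. Poly_Mapping.lookup f l * (\<Sum>q. Poly_Mapping.lookup g q when 0 = l + q))"
    by (simp add: lookup_mult)
  also have "\<dots> = (\<Sum>l. (Poly_Mapping.lookup f l * Poly_Mapping.lookup g 0) when l = 0)"
    by (rule Sum_any.cong) (auto simp: eq when_def)
  finally show "Poly_Mapping.lookup (f * g) 0 = Poly_Mapping.lookup f 0 * Poly_Mapping.lookup g 0" by simp
qed (simp_all add: lookup_add)

lemma lookup_monomial_mult: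
  fixes f :: "('v, 'k::field) mpoly"
  shows "Poly_Mapping.lookup (Poly_Mapping.single m 1 * f) (m + k) = Poly_Mapping.lookup f k"
proof -
  have "Poly_Mapping.lookup (Poly_Mapping.single m 1 * f) (m + k) =
      (\<Sum>l. Poly_Mapping.lookup (Poly_Mapping.single m (1::'k)) l * (\<Sum>q. Poly_Mapping.lookup f q when m + k = l + q))"
    by (simp add: lookup_mult)
  also have "\<dots> = (\<Sum>l. Poly_Mapping.lookup f k when l = m)"
    by (rule Sum_any.cong) (auto simp: lookup_single when_def)
  finally show ?thesis by simp
qed

lemma keys_monomial_mult:
  fixes f :: "('v, 'k::field) mpoly"
  shows "Poly_Mapping.keys (Poly_Mapping.single m 1 * f) = (+) m ` Poly_Mapping.keys f"
proof
  show "Poly_Mapping.keys (Poly_Mapping.single m 1 * f) \<subseteq> (+) m ` Poly_Mapping.keys f"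
    using keys_poly_mult[of _ "Poly_Mapping.single m 1" f] by auto
  show "(+) m ` Poly_Mapping.keys f \<subseteq> Poly_Mapping.keys (Poly_Mapping.single m 1 * f)"
    by (auto simp: in_keys_iff lookup_monomial_mult)
qed

lemma poly_sum_monomials:
  "f = (\<Sum>k\<in>Poly_Mapping.keys f. Poly_Mapping.single k (Poly_Mapping.lookup f k))"
  by (rule poly_mapping_eqI) (simp add: lookup_sum lookup_single when_def in_keys_iff)

section \<open>Homogeneous components\<close>

definition homogeneous :: "nat \<Rightarrow> ('v, 'k::field) mpoly \<Rightarrow> bool" where
  "homogeneous n f \<longleftrightarrow> (\<forall>m\<in>Poly_Mapping.keys f. total_degree m = n)"

definition homogeneous_part :: "nat \<Rightarrow> ('v, 'k::field) mpoly \<Rightarrow> ('v, 'k) mpoly" where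
  "homogeneous_part n = Poly_Mapping.mapp (\<lambda>m c. c when total_degree m = n)"

lemma lookup_homogeneous_part: "Poly_Mapping.lookup (homogeneous_part n f) m = (Poly_Mapping.lookup f m when total_degree m = n)"
  by (simp add: homogeneous_part_def lookup_mapp when_def in_keys_iff)

lemma homogeneous_part_zero: "homogeneous_part n 0 = 0"
  by (rule poly_mapping_eqI) (simp add: lookup_homogeneous_part)

lemma homogeneous_part_add: "homogeneous_part n (f + g) = homogeneous_part n f + homogeneous_part n g"
  by (rule poly_mapping_eqI) (simp add: lookup_homogeneous_part lookup_add when_add_distrib)

lemma homogeneous_part_sum: "homogeneous_part n (sum f S) = (\<Sum>x\<in>S. homogeneous_part n (f x))"
  by (induct S rule: infinite_finite_induct) (simp_all add: homogeneous_part_zero homogeneous_part_add)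

lemma homogeneous_part_closed: "f \<in> carrier (poly_ring V) \<Longrightarrow> homogeneous_part n f \<in> carrier (poly_ring V)"
  by (auto simp: poly_ring_carrier in_keys_iff lookup_homogeneous_part when_def split: if_splits)

lemma homogeneous_homogeneous_part: "homogeneous n (homogeneous_part n f)"
  by (auto simp: homogeneous_def in_keys_iff lookup_homogeneous_part)

lemma homogeneous_part_homogeneous: "homogeneous n f \<Longrightarrow> homogeneous_part n f = f"
  by (rule poly_mapping_eqI) (auto simp: lookup_homogeneous_part homogeneous_def in_keys_iff when_def)

lemma homogeneous_mult: "homogeneous a f \<Longrightarrow> homogeneous b g \<Longrightarrow> homogeneous (a + b) (f * g)"
  using keys_poly_mult[of _ f g] by (fastforce simp: homogeneous_def total_degree_add)

lemma homogeneous_zero: "homogeneous n 0"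
  by (simp add: homogeneous_def)

lemma homogeneous_uminus: "homogeneous n f \<Longrightarrow> homogeneous n (- f)"
  by (simp add: homogeneous_def in_keys_iff)

lemma homogeneous_monomial: "homogeneous (total_degree m) (Poly_Mapping.single m 1)"
  by (simp add: homogeneous_def)

lemma homogeneous_1_constant_term: "homogeneous 1 f \<Longrightarrow> Poly_Mapping.lookup f 0 = 0"
proof (rule ccontr)
  assume f: "homogeneous 1 f" and "Poly_Mapping.lookup f 0 \<noteq> 0"
  then have "0 \<in> Poly_Mapping.keys f" by (simp add: in_keys_iff)
  with f show False by (auto simp: homogeneous_def total_degree_zero)
qed

text \<open>Multiplication by a homogeneous polynomial shifts degrees, so it commutes with taking homogeneous
parts up to this shift. Therefore every solution of a homogeneous linear system can be replaced by its
homogeneous part of the right degree.\<close>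

lemma homogeneous_part_mult:
  assumes "homogeneous a f"
  shows "homogeneous_part (a + n) (f * g) = f * homogeneous_part n g"
proof (rule poly_mapping_eqI)
  fix k
  show "Poly_Mapping.lookup (homogeneous_part (a + n) (f * g)) k = Poly_Mapping.lookup (f * homogeneous_part n g) k"
  proof (cases "total_degree k = a + n")
    case True
    have *: "Poly_Mapping.lookup f l * (\<Sum>q. Poly_Mapping.lookup g q when k = l + q) =
      Poly_Mapping.lookup f l * (\<Sum>q. (Poly_Mapping.lookup g q when total_degree q = n) when k = l + q)" for l
    proof (cases "Poly_Mapping.lookup f l = 0")
      case False
      then have "total_degree l = a" using assms by (simp add: homogeneous_def in_keys_iff)
      then have "(Poly_Mapping.lookup g q when k = l + q) =
        ((Poly_Mapping.lookup g q when total_degree q = n) when k = l + q)" for q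
        using True by (auto simp: when_def total_degree_add)
      then show ?thesis by simp
    qed simp
    show ?thesis using True by (simp only: lookup_homogeneous_part lookup_mult * when_simps simp_thms)
  next
    case False
    have *: "Poly_Mapping.lookup f l * (\<Sum>q. (Poly_Mapping.lookup g q when total_degree q = n) when k = l + q) = 0" for l
    proof (cases "Poly_Mapping.lookup f l = 0")
      case f: False
      then have "total_degree l = a" using assms by (simp add: homogeneous_def in_keys_iff)
      then have "((Poly_Mapping.lookup g q when total_degree q = n) when k = l + q) = 0" for q
        using False by (auto simp: when_def total_degree_add)
      then show ?thesis by simp
    qed simp
    have "Poly_Mapping.lookup (f * homogeneous_part n g) k = 0"
      by (simp only: lookup_homogeneous_part lookup_mult *) simp
    then show ?thesis using False by (simp add: lookup_homogeneous_part)
  qed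
qed

lemma homogeneous_part_mat_mult_left:
  assumes A: "A \<in> carrier_mat n m" and B: "B \<in> carrier_mat m l"
    and hA: "\<And>i j. i < n \<Longrightarrow> j < m \<Longrightarrow> homogeneous a (A $$ (i, j))"
  shows "map_mat (homogeneous_part (a + b)) (A * B) = A * map_mat (homogeneous_part b) B"
proof (rule eq_matI)
  fix i j assume "i < dim_row (A * map_mat (homogeneous_part b) B)" "j < dim_col (A * map_mat (homogeneous_part b) B)"
  then have "i < n" "j < l" using A B by auto
  then show "map_mat (homogeneous_part (a + b)) (A * B) $$ (i, j) = (A * map_mat (homogeneous_part b) B) $$ (i, j)"
    using A B hA by (simp add: scalar_prod_def homogeneous_part_sum homogeneous_part_mult)
qed (use A B in auto)

lemma homogeneous_part_mat_mult_right:
  assumes A: "A \<in> carrier_mat n m" and B: "B \<in> carrier_mat m l"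
    and hB: "\<And>i j. i < m \<Longrightarrow> j < l \<Longrightarrow> homogeneous b (B $$ (i, j))"
  shows "map_mat (homogeneous_part (b + a)) (A * B) = map_mat (homogeneous_part a) A * B"
proof (rule eq_matI)
  fix i j assume "i < dim_row (map_mat (homogeneous_part a) A * B)" "j < dim_col (map_mat (homogeneous_part a) A * B)"
  then have ij: "i < n" "j < l" using A B by auto
  then have "homogeneous_part (b + a) (A $$ (i, k) * B $$ (k, j)) = homogeneous_part a (A $$ (i, k)) * B $$ (k, j)" if "k < m" for k
    using homogeneous_part_mult[OF hB[OF that ij(2)]] by (simp add: mult.commute)
  then show "map_mat (homogeneous_part (b + a)) (A * B) $$ (i, j) = (map_mat (homogeneous_part a) A * B) $$ (i, j)"
    using A B ij by (simp add: scalar_prod_def homogeneous_part_sum)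
qed (use A B in auto)

section \<open>Linear resolutions\<close>

lemma free_resolution_iff_resolution:
  fixes D :: "nat \<Rightarrow> ('v, 'k::field) mpoly mat"
  shows "free_resolution V I r D \<longleftrightarrow> poly.resolution V I r D"
proof -
  have vecs: "poly.vecs V n = free_module V n" for n
    by (simp add: poly.vecs_def free_module_def)
  have mats: "A \<in> poly.mats V n m \<longleftrightarrow> A \<in> carrier_mat n m \<and> elements_mat A \<subseteq> carrier (poly_ring V)"
    for A :: "('v, 'k) mpoly mat" and n m
  proof
    assume "A \<in> carrier_mat n m \<and> elements_mat A \<subseteq> carrier (poly_ring V)"
    then show "A \<in> poly.mats V n m" using elements_matI by (auto simp: poly.mats_def)
  next
    assume "A \<in> poly.mats V n m"
    then show "A \<in> carrier_mat n m \<and> elements_mat A \<subseteq> carrier (poly_ring V)"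
      by (auto simp: poly.mats_def dest!: elements_matD)
  qed
  show ?thesis
    unfolding free_resolution_def poly.resolution_def mats vecs ..
qed

text \<open>A free resolution with generators in degree \<open>d\<close> and linear forms as entries of all higher
matrices. Such a resolution is minimal: linear forms have no constant term.\<close>

definition linear_resolution ::
  "'v set \<Rightarrow> nat \<Rightarrow> ('v, 'k::field) mpoly set \<Rightarrow> (nat \<Rightarrow> nat) \<Rightarrow> bool" where
  "linear_resolution V d I r \<longleftrightarrow> (\<exists>D. poly.resolution V I r D \<and>
     (\<forall>j<r 0. homogeneous d (D 0 $$ (0, j))) \<and>
     (\<forall>p. \<forall>i<r p. \<forall>j<r (Suc p). homogeneous 1 (D (Suc p) $$ (i, j))))"

text \<open>The resolution behind \<open>betti\<close> is arbitrary; comparing it with the given linear one determines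
its homology after reduction to constant terms.\<close>

theorem betti_linear_resolution:
  assumes "linear_resolution V d I s"
  shows "betti V I i = s i"
proof -
  from assms obtain E where E: "poly.resolution V I s E"
    and hom: "\<And>p i j. i < s p \<Longrightarrow> j < s (Suc p) \<Longrightarrow> homogeneous 1 (E (Suc p) $$ (i, j))"
    by (auto simp: linear_resolution_def)
  define c where "c = (SOME (r, D). free_resolution V I r D)"
  have "\<exists>c. case c of (r, D) \<Rightarrow> free_resolution V I r D"
    using E by (intro exI[of _ "(s, E)"]) (simp add: free_resolution_iff_resolution)
  from someI_ex[OF this] have c: "case c of (r, D) \<Rightarrow> free_resolution V I r D"
    unfolding c_def .
  obtain r D where rD: "c = (r, D)" by (cases c)
  have D: "poly.resolution V I r D" using c by (simp add: rD free_resolution_iff_resolution)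
  have "kernel_dim (tensored_map r D i) = s i + vec_space.rank (r i) (tensored_map r D (Suc i))"
  proof (rule poly.kernel_dim_tensored_resolution[OF comm_ring_hom_constant_term D E])
    fix p
    show "map_mat (\<lambda>f. Poly_Mapping.lookup f 0) (E (Suc p)) = 0\<^sub>m (s p) (s (Suc p))"
      using poly.matsD[OF poly.resolution_mats_Suc[OF E, of p]] homogeneous_1_constant_term[OF hom]
      by (intro eq_matI) auto
  qed (simp_all add: tensored_map_def)
  then show ?thesis by (simp add: betti_def c_def[symmetric] rD tor_dim_def)
qed

lemma linear_resolution_zero: "linear_resolution V d {0} (\<lambda>_. 0)"
proof -
  let ?D = "\<lambda>p. 0\<^sub>m (case p of 0 \<Rightarrow> 1 | Suc _ \<Rightarrow> 0) 0 :: ('a, 'b) mpoly mat"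
  have v: "poly.vecs V 0 = {0\<^sub>v 0}" for V :: "'a set"
    by (auto simp: poly.vecs_def)
  have "poly.resolution V {0} (\<lambda>_. 0) ?D"
    unfolding poly.resolution_def v
  proof (intro conjI allI)
    fix p
    show "?D p \<in> poly.mats V (case p of 0 \<Rightarrow> 1 | Suc _ \<Rightarrow> 0) 0"
      by (simp add: poly.mats_def)
    have "?D (Suc p) *\<^sub>v 0\<^sub>v 0 = 0\<^sub>v 0" by (rule eq_vecI) simp_all
    moreover have "0\<^sub>v 0 \<in> mat_kernel (?D p)"
      by (intro mat_kernelI[OF zero_carrier_mat]) (simp_all add: zero_mat_mult_vec)
    ultimately show "(\<lambda>v. ?D (Suc p) *\<^sub>v v) ` {0\<^sub>v 0} = mat_kernel (?D p) \<inter> {0\<^sub>v 0}" by simp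
  qed (simp add: scalar_prod_def)
  then show ?thesis unfolding linear_resolution_def by (intro exI[of _ ?D]) simp
qed

text \<open>The chain map \<open>g\<close> that lifts multiplication by \<open>c\<close> may have entries of several degrees. Since
\<open>c\<close> has degree \<open>d\<close> and all matrices involved are homogeneous, the degree 1 part \<open>f\<close> of \<open>g\<close>
satisfies the same equations, and with it the glued resolution is again linear.\<close>

lemma linear_resolution_extend:
  assumes I: "linear_resolution V d I r" and J: "linear_resolution V 1 J s"
    and c: "c \<in> carrier (poly_ring V)" "homogeneous d c"
    and colon: "J = {x \<in> carrier (poly_ring V). c * x \<in> I}"
  shows "linear_resolution V d {x + c * y |x y. x \<in> I \<and> y \<in> carrier (poly_ring V)}
    (\<lambda>p. r p + (case p of 0 \<Rightarrow> 1 | Suc q \<Rightarrow> s q))"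
proof -
  from I obtain D where D: "poly.resolution V I r D" and hD0: "\<And>j. j < r 0 \<Longrightarrow> homogeneous d (D 0 $$ (0, j))"
    and hD: "\<And>p i j. i < r p \<Longrightarrow> j < r (Suc p) \<Longrightarrow> homogeneous 1 (D (Suc p) $$ (i, j))"
    by (auto simp: linear_resolution_def)
  from J obtain E where E: "poly.resolution V J s E" and hE0: "\<And>j. j < s 0 \<Longrightarrow> homogeneous 1 (E 0 $$ (0, j))"
    and hE: "\<And>p i j. i < s p \<Longrightarrow> j < s (Suc p) \<Longrightarrow> homogeneous 1 (E (Suc p) $$ (i, j))"
    by (auto simp: linear_resolution_def)
  note cD0 = poly.matsD[OF poly.resolution_mats_0[OF D]] and cD = poly.matsD[OF poly.resolution_mats_Suc[OF D]]
  note cE0 = poly.matsD[OF poly.resolution_mats_0[OF E]] and cE = poly.matsD[OF poly.resolution_mats_Suc[OF E]]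
  obtain g where g: "\<And>p. g p \<in> poly.mats V (r p) (s p)" "D 0 * g 0 = c \<cdot>\<^sub>m E 0"
      "\<And>p. D (Suc p) * g (Suc p) = g p * E (Suc p)"
    using poly.comparison_map[OF D poly.resolution_mats[OF E] poly.resolution_complex[OF E] c(1)]
      poly.resolution_entry[OF E] colon by auto
  note cg = poly.matsD[OF g(1)]
  define f where "f p = map_mat (homogeneous_part 1) (g p)" for p
  have f: "f p \<in> poly.mats V (r p) (s p)" for p
    using g(1)[of p] by (auto simp: f_def poly.mats_def intro!: homogeneous_part_closed)
  have "D 0 * f 0 = map_mat (homogeneous_part (d + 1)) (D 0 * g 0)"
    unfolding f_def using hD0 by (intro homogeneous_part_mat_mult_left[OF cD0 cg, symmetric]) auto
  also have "\<dots> = c \<cdot>\<^sub>m E 0"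
    unfolding g(2) using cE0 hE0 c(2)
    by (intro eq_matI) (auto intro!: homogeneous_part_homogeneous homogeneous_mult[where b = 1, simplified])
  finally have f0: "D 0 * f 0 = c \<cdot>\<^sub>m E 0" .
  have fS: "D (Suc p) * f (Suc p) = f p * E (Suc p)" for p
  proof -
    have "D (Suc p) * f (Suc p) = map_mat (homogeneous_part (1 + 1)) (D (Suc p) * g (Suc p))"
      unfolding f_def using hD by (intro homogeneous_part_mat_mult_left[OF cD cg, symmetric])
    also have "\<dots> = f p * E (Suc p)"
      unfolding f_def g(3) using hE by (intro homogeneous_part_mat_mult_right[OF cg cE])
    finally show ?thesis .
  qed
  let ?r = "poly.extend_ranks r s" and ?N = "poly.extend_mats c r D s E f"
  have res: "poly.resolution V {x + c * y |x y. x \<in> I \<and> y \<in> carrier (poly_ring V)} ?r ?N"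
    by (rule poly.resolution_extend[OF D E c(1) colon f f0 fS])
  have hN0: "homogeneous d (?N 0 $$ (0, j))" if "j < ?r 0" for j
    using that hD0 c(2) cD0 by (simp add: poly.extend_ranks_def poly.extend_mats_def)
  have hf: "homogeneous 1 (f p $$ (i, j))" if "i < r p" "j < s p" for p i j
    using that cg[of p] by (simp add: f_def homogeneous_homogeneous_part)
  have hN: "homogeneous 1 (?N (Suc p) $$ (i, j))" if "i < ?r p" "j < ?r (Suc p)" for p i j
  proof -
    have hE': "homogeneous 1 (E p $$ (i, j))" if "i < (case p of 0 \<Rightarrow> 1 | Suc q \<Rightarrow> s q)" "j < s p" for i j
      using that hE0 hE by (cases p) auto
    have cE': "E p \<in> carrier_mat (case p of 0 \<Rightarrow> 1 | Suc q \<Rightarrow> s q) (s p)"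
      using poly.matsD[OF poly.resolution_mats[OF E]] .
    have cf: "f p \<in> carrier_mat (r p) (s p)" using poly.matsD[OF f] .
    show ?thesis
      using that hD[of i p j] hf[of i p "j - r (Suc p)"] hE'[of "i - r p" "j - r (Suc p)"] cD[of p] cE' cf
      by (auto simp: poly.extend_ranks_def poly.extend_mats_def homogeneous_zero intro!: homogeneous_uminus)
  qed
  show ?thesis
    unfolding linear_resolution_def
    using res hN0 hN by (intro exI[of _ ?N]) (simp add: poly.extend_ranks_def[abs_def])
qed

section \<open>Monomial ideals\<close>

text \<open>The ideal generated by the monomials in \<open>G\<close>, described by its elements
(\<open>genideal_monomials\<close>). In this form membership and colon ideals reduce to divisibility of monomials.\<close>

definition mono_ideal :: "'v set \<Rightarrow> ('v \<Rightarrow>\<^sub>0 nat) set \<Rightarrow> ('v, 'k::field) mpoly set" where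
  "mono_ideal V G = {f \<in> carrier (poly_ring V). \<forall>m\<in>Poly_Mapping.keys f. \<exists>g\<in>G. monomial_dvd g m}"

lemma mono_ideal_zero: "0 \<in> mono_ideal V G"
  by (simp add: mono_ideal_def poly.zero_closed)

lemma mono_ideal_add: "f \<in> mono_ideal V G \<Longrightarrow> g \<in> mono_ideal V G \<Longrightarrow> f + g \<in> mono_ideal V G"
  unfolding mono_ideal_def mem_Collect_eq by (meson poly.add_closed keys_poly_add)

lemma mono_ideal_mult:
  assumes f: "f \<in> mono_ideal V G" and h: "h \<in> carrier (poly_ring V)"
  shows "h * f \<in> mono_ideal V G"
proof -
  have "\<exists>g\<in>G. monomial_dvd g m" if m: "m \<in> Poly_Mapping.keys (h * f)" for m
  proof -
    from keys_poly_mult[OF m] obtain a b where ab: "b \<in> Poly_Mapping.keys f" "m = a + b" by blast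
    then obtain g where g: "g \<in> G" "monomial_dvd g b" using f by (auto simp: mono_ideal_def)
    then show ?thesis using monomial_dvd_trans[OF g(2) monomial_dvd_add_right] ab by blast
  qed
  moreover have "h * f \<in> carrier (poly_ring V)"
    using poly.mult_closed[OF h] f by (simp add: mono_ideal_def)
  ultimately show ?thesis by (simp add: mono_ideal_def)
qed

lemma monomial_in_mono_ideal:
  "(Poly_Mapping.single m 1 :: ('v, 'k::field) mpoly) \<in> mono_ideal V G \<longleftrightarrow>
    Poly_Mapping.keys m \<subseteq> V \<and> (\<exists>g\<in>G. monomial_dvd g m)"
  by (simp add: mono_ideal_def poly_ring_carrier)

lemma abelian_group_poly_ring: "abelian_group (poly_ring V :: ('v, 'k::field) mpoly ring)"
proof (rule abelian_groupI)
  fix x :: "('v, 'k) mpoly" assume "x \<in> carrier (poly_ring V)"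
  from poly.uminus_closed[OF this]
  show "\<exists>y\<in>carrier (poly_ring V). y \<oplus>\<^bsub>poly_ring V\<^esub> x = \<zero>\<^bsub>poly_ring V\<^esub>"
    by (intro bexI[of _ "- x"]) (simp_all add: poly_ring_def)
qed (use poly.zero_closed[of V] poly.add_closed[of _ V] in \<open>simp_all add: poly_ring_def ac_simps\<close>)

lemma ring_poly_ring: "ring (poly_ring V :: ('v, 'k::field) mpoly ring)"
proof (rule ringI[OF abelian_group_poly_ring])
  show "monoid (poly_ring V :: ('v, 'k) mpoly ring)"
    by (rule monoidI) (use poly.one_closed[of V] poly.mult_closed[of _ V] in
      \<open>simp_all add: poly_ring_def ac_simps\<close>)
qed (simp_all add: poly_ring_def algebra_simps)

lemma ideal_mono_ideal: "ideal (mono_ideal V G) (poly_ring V :: ('v, 'k::field) mpoly ring)"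
proof (rule idealI[OF ring_poly_ring])
  interpret abelian_group "poly_ring V :: ('v, 'k) mpoly ring" by (rule abelian_group_poly_ring)
  have inv: "inv\<^bsub>add_monoid (poly_ring V)\<^esub> f = - f" if "f \<in> carrier (poly_ring V)" for f :: "('v, 'k) mpoly"
    using that poly.uminus_closed[OF that]
    by (intro group.inv_equality[OF a_group]) (simp_all add: poly_ring_def)
  show "subgroup (mono_ideal V G) (add_monoid (poly_ring V :: ('v, 'k) mpoly ring))"
  proof
    show "mono_ideal V G \<subseteq> carrier (add_monoid (poly_ring V :: ('v, 'k) mpoly ring))"
      by (auto simp: mono_ideal_def)
    fix f g :: "('v, 'k) mpoly" assume f: "f \<in> mono_ideal V G"
    have "- 1 \<in> carrier (poly_ring V :: ('v, 'k) mpoly ring)"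
      by (rule poly.uminus_closed[OF poly.one_closed])
    from mono_ideal_mult[OF f this]
    show "inv\<^bsub>add_monoid (poly_ring V)\<^esub> f \<in> mono_ideal V G"
      using f by (subst inv) (simp_all add: mono_ideal_def)
    assume "g \<in> mono_ideal V G"
    with f show "f \<otimes>\<^bsub>add_monoid (poly_ring V)\<^esub> g \<in> mono_ideal V G"
      using mono_ideal_add by (simp add: poly_ring_def)
  qed (simp add: poly_ring_def mono_ideal_zero)
qed (use mono_ideal_mult in \<open>auto simp: poly_ring_def mult.commute\<close>)

text \<open>Induction over the terms of a fixed polynomial; only monomials that occur in \<open>f\<close> have to be treated.\<close>

lemma poly_induct_monomials:
  assumes "f \<in> carrier (poly_ring V)" and "P 0" and "\<And>g h. P g \<Longrightarrow> P h \<Longrightarrow> P (g + h)"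
    and "\<And>k c. k \<in> Poly_Mapping.keys f \<Longrightarrow> P (Poly_Mapping.single k c)"
  shows "P f"
proof -
  have "P (\<Sum>k\<in>S. Poly_Mapping.single k (Poly_Mapping.lookup f k))" if "S \<subseteq> Poly_Mapping.keys f" for S
    using finite_subset[OF that finite_keys] that by (induct S rule: finite_induct) (use assms in auto)
  from this[OF order_refl] show ?thesis using poly_sum_monomials[of f] by simp
qed

lemma single_closed: "Poly_Mapping.keys k \<subseteq> V \<Longrightarrow> Poly_Mapping.single k c \<in> carrier (poly_ring V)"
  by (simp add: poly_ring_carrier)

lemma keys_minus_subset: "Poly_Mapping.keys (k - g) \<subseteq> Poly_Mapping.keys (k :: 'v \<Rightarrow>\<^sub>0 nat)"
  by (auto simp: in_keys_iff lookup_minus)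

lemma single_eq_mult:
  "monomial_dvd g k \<Longrightarrow> Poly_Mapping.single k (c::'k::field) = Poly_Mapping.single g 1 * Poly_Mapping.single (k - g) c"
  using monomial_dvd_imp_add[of g k] by (simp add: mult_single add.commute)

lemma genideal_monomials:
  assumes G: "\<And>g. g \<in> G \<Longrightarrow> Poly_Mapping.keys g \<subseteq> V"
  shows "genideal (poly_ring V) ((\<lambda>g. Poly_Mapping.single g (1::'k::field)) ` G) = mono_ideal V G"
    (is "genideal _ ?S = _")
proof
  interpret ring "poly_ring V :: ('a, 'k) mpoly ring" by (rule ring_poly_ring)
  have "?S \<subseteq> mono_ideal V G"
    unfolding image_subset_iff monomial_in_mono_ideal using G monomial_dvd_refl by blast
  then show "genideal (poly_ring V) ?S \<subseteq> mono_ideal V G"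
    by (rule genideal_minimal[OF ideal_mono_ideal])
  have S: "?S \<subseteq> carrier (poly_ring V)"
    unfolding image_subset_iff using G by (blast intro: single_closed)
  interpret I: ideal "genideal (poly_ring V) ?S" "poly_ring V :: ('a, 'k) mpoly ring"
    by (rule genideal_ideal[OF S])
  show "mono_ideal V G \<subseteq> genideal (poly_ring V) ?S"
  proof
    fix f :: "('a, 'k) mpoly" assume f: "f \<in> mono_ideal V G"
    then have fV: "f \<in> carrier (poly_ring V)" by (simp add: mono_ideal_def)
    show "f \<in> genideal (poly_ring V) ?S"
    proof (rule poly_induct_monomials[OF fV])
      show "0 \<in> genideal (poly_ring V) ?S" using additive_subgroup.zero_closed[OF I.additive_subgroup_axioms] by (simp add: poly_ring_def)
      show "g + h \<in> genideal (poly_ring V) ?S"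
        if "g \<in> genideal (poly_ring V) ?S" "h \<in> genideal (poly_ring V) ?S" for g h
        using I.a_closed[OF that] by (simp add: poly_ring_def)
      fix k and c :: 'k assume k: "k \<in> Poly_Mapping.keys f"
      then obtain g where g: "g \<in> G" "monomial_dvd g k" using f by (auto simp: mono_ideal_def)
      have kV: "Poly_Mapping.keys k \<subseteq> V" using k fV by (simp add: poly_ring_carrier)
      have "Poly_Mapping.single g 1 \<in> genideal (poly_ring V) ?S"
        using genideal_self[OF S] g(1) by blast
      moreover have "Poly_Mapping.single (k - g) c \<in> carrier (poly_ring V)"
        using keys_minus_subset[of k g] kV by (intro single_closed) blast
      ultimately show "Poly_Mapping.single k c \<in> genideal (poly_ring V) ?S"
        using I.I_r_closed[of "Poly_Mapping.single g 1" "Poly_Mapping.single (k - g) c"] single_eq_mult[OF g(2), of c]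
        by (simp add: poly_ring_def)
    qed
  qed
qed

text \<open>Generators of equal degree divide each other only if they are equal, so all of them are minimal.\<close>

lemma min_gens_mono_ideal:
  assumes G: "\<And>g. g \<in> G \<Longrightarrow> Poly_Mapping.keys g \<subseteq> V" and d: "\<And>g. g \<in> G \<Longrightarrow> total_degree g = d"
  shows "min_gens (mono_ideal V G :: ('v, 'k::field) mpoly set) = G"
proof (intro equalityI subsetI)
  fix m assume m: "m \<in> min_gens (mono_ideal V G :: ('v, 'k) mpoly set)"
  then obtain g where g: "g \<in> G" "monomial_dvd g m" by (auto simp: min_gens_def monomial_in_mono_ideal)
  then have "Poly_Mapping.single g 1 \<in> (mono_ideal V G :: ('v, 'k) mpoly set)"
    using G monomial_dvd_refl by (auto simp: monomial_in_mono_ideal)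
  then have "g = m" using m g(2) by (auto simp: min_gens_def monomial_dvd_def)
  then show "m \<in> G" using g by simp
next
  fix g assume g: "g \<in> G"
  have "m' = g" if m': "Poly_Mapping.keys m' \<subseteq> V" "h \<in> G" "monomial_dvd h m'" "monomial_dvd m' g" for m' h
  proof -
    have "h = g" using monomial_dvd_total_degree_eq[OF monomial_dvd_trans[OF m'(3,4)]] d g m'(2) by simp
    with m'(3,4) show ?thesis by (auto simp: monomial_dvd_def intro!: poly_mapping_eqI antisym)
  qed
  then show "g \<in> min_gens (mono_ideal V G :: ('v, 'k) mpoly set)"
    using g G monomial_dvd_refl unfolding min_gens_def mem_Collect_eq monomial_in_mono_ideal monomial_dvd_def[symmetric]
    by blast
qed

lemma mono_ideal_insert:
  assumes m: "Poly_Mapping.keys m \<subseteq> V"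
  shows "mono_ideal V (insert m G) =
    {x + Poly_Mapping.single m 1 * y |x y. x \<in> mono_ideal V G \<and> y \<in> carrier (poly_ring V)}"
    (is "?L = ?R")
proof (intro equalityI subsetI)
  fix f assume f: "f \<in> ?L"
  then have fV: "f \<in> carrier (poly_ring V)" by (simp add: mono_ideal_def)
  show "f \<in> ?R"
  proof (rule poly_induct_monomials[OF fV])
    have "0 = 0 + Poly_Mapping.single m 1 * 0" by simp
    then show "0 \<in> ?R" using mono_ideal_zero[of V G] poly.zero_closed[of V] by blast
    fix g h assume "g \<in> ?R" "h \<in> ?R"
    then obtain x y x' y' where "x \<in> mono_ideal V G" "y \<in> carrier (poly_ring V)"
      "x' \<in> mono_ideal V G" "y' \<in> carrier (poly_ring V)"
      and gh: "g = x + Poly_Mapping.single m 1 * y" "h = x' + Poly_Mapping.single m 1 * y'" by blast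
    moreover from this have "x + x' \<in> mono_ideal V G" "y + y' \<in> carrier (poly_ring V)"
      using mono_ideal_add poly.add_closed by blast+
    moreover have "g + h = (x + x') + Poly_Mapping.single m 1 * (y + y')"
      by (simp add: gh algebra_simps)
    ultimately show "g + h \<in> ?R" by blast
  next
    fix k c assume k: "k \<in> Poly_Mapping.keys f"
    then have kV: "Poly_Mapping.keys k \<subseteq> V" using fV by (simp add: poly_ring_carrier)
    show "Poly_Mapping.single k c \<in> ?R"
    proof (cases "monomial_dvd m k")
      case True
      have "Poly_Mapping.single (k - m) c \<in> carrier (poly_ring V)"
        using keys_minus_subset[of k m] kV by (intro single_closed) blast
      moreover have "Poly_Mapping.single k c = 0 + Poly_Mapping.single m 1 * Poly_Mapping.single (k - m) c"
        using single_eq_mult[OF True, of c] by simp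
      ultimately show ?thesis using mono_ideal_zero[of V G] by blast
    next
      case False
      then have "\<exists>g\<in>G. monomial_dvd g k" using f k by (auto simp: mono_ideal_def)
      then have "Poly_Mapping.single k c \<in> mono_ideal V G"
        using single_closed[OF kV, of c] by (simp add: mono_ideal_def)
      moreover have "Poly_Mapping.single k c = Poly_Mapping.single k c + Poly_Mapping.single m 1 * 0" by simp
      ultimately show ?thesis using poly.zero_closed[of V] by blast
    qed
  qed
next
  fix f assume "f \<in> ?R"
  then obtain x y where xy: "x \<in> mono_ideal V G" "y \<in> carrier (poly_ring V)"
    "f = x + Poly_Mapping.single m 1 * y" by blast
  have "x \<in> ?L" using xy(1) by (auto simp: mono_ideal_def)
  moreover have "Poly_Mapping.single m 1 \<in> ?L"
    using m monomial_dvd_refl by (auto simp: monomial_in_mono_ideal)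
  from mono_ideal_mult[OF this xy(2)] have "Poly_Mapping.single m 1 * y \<in> ?L" by (simp add: mult.commute)
  ultimately show "f \<in> ?L" unfolding xy(3) by (rule mono_ideal_add)
qed

lemma mono_ideal_colon:
  assumes m: "Poly_Mapping.keys m \<subseteq> V"
    and H: "\<And>k. (\<exists>h\<in>H. monomial_dvd h k) \<longleftrightarrow> (\<exists>g\<in>G. monomial_dvd g (m + k))"
  shows "mono_ideal V H = {x \<in> carrier (poly_ring V). Poly_Mapping.single m 1 * x \<in> mono_ideal V G}"
  using poly.mult_closed[OF single_closed[OF m]] H
  by (auto simp: mono_ideal_def keys_monomial_mult)

section \<open>Linear quotients\<close>

abbreviation mvar :: "'v \<Rightarrow> 'v \<Rightarrow>\<^sub>0 nat" where
  "mvar x \<equiv> Poly_Mapping.single x 1"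

text \<open>The premises \<open>separated\<close> and \<open>reached\<close> say together that the colon ideal of \<open>G\<close> by \<open>m\<close> is
generated by the variables in \<open>Q\<close>: a monomial \<open>k\<close> for which \<open>m + k\<close> is divisible by some \<open>g\<close> contains
the variable in which \<open>g\<close> exceeds \<open>m\<close>, and each variable in \<open>Q\<close> lies in the colon ideal.\<close>

lemma linear_quotient_step:
  assumes r: "linear_resolution V d (mono_ideal V G :: ('v, 'k::field) mpoly set) r"
    and s: "linear_resolution V 1 (mono_ideal V (mvar ` Q) :: ('v, 'k) mpoly set) s"
    and m: "Poly_Mapping.keys m \<subseteq> V" "total_degree m = d"
    and separated: "\<And>g. g \<in> G \<Longrightarrow> \<exists>x\<in>Q. Poly_Mapping.lookup m x < Poly_Mapping.lookup g x"
    and reached: "\<And>x. x \<in> Q \<Longrightarrow> \<exists>g\<in>G. monomial_dvd g (m + mvar x)"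
  shows "linear_resolution V d (mono_ideal V (insert m G) :: ('v, 'k) mpoly set)
    (\<lambda>p. r p + (case p of 0 \<Rightarrow> 1 | Suc q \<Rightarrow> s q))"
  unfolding mono_ideal_insert[OF m(1)]
proof (rule linear_resolution_extend[OF r s single_closed[OF m(1)]])
  show "homogeneous d (Poly_Mapping.single m 1 :: ('v, 'k) mpoly)"
    using homogeneous_monomial[of m] m(2) by simp
  show "mono_ideal V (mvar ` Q) = {x \<in> carrier (poly_ring V).
    (Poly_Mapping.single m 1 :: ('v, 'k) mpoly) * x \<in> mono_ideal V G}"
  proof (rule mono_ideal_colon[OF m(1)])
    fix k
    show "(\<exists>h\<in>mvar ` Q. monomial_dvd h k) \<longleftrightarrow> (\<exists>g\<in>G. monomial_dvd g (m + k))"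
    proof
      assume "\<exists>h\<in>mvar ` Q. monomial_dvd h k"
      then obtain x where x: "x \<in> Q" "monomial_dvd (mvar x) k" by blast
      from reached[OF x(1)] obtain g where g: "g \<in> G" "monomial_dvd g (m + mvar x)" by blast
      with monomial_dvd_trans[OF g(2) monomial_dvd_add_mono[OF x(2)]] show "\<exists>g\<in>G. monomial_dvd g (m + k)" by blast
    next
      assume "\<exists>g\<in>G. monomial_dvd g (m + k)"
      then obtain g where g: "g \<in> G" "monomial_dvd g (m + k)" by blast
      from separated[OF g(1)] obtain x where x: "x \<in> Q" "Poly_Mapping.lookup m x < Poly_Mapping.lookup g x" by blast
      have "Poly_Mapping.lookup g x \<le> Poly_Mapping.lookup m x + Poly_Mapping.lookup k x"
        using g(2) by (simp add: monomial_dvd_def lookup_add)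
      with x(2) have "x \<in> Poly_Mapping.keys k" by (simp add: in_keys_iff)
      then have "monomial_dvd (mvar x) k" by (rule iffD2[OF monomial_dvd_single_iff])
      then show "\<exists>h\<in>mvar ` Q. monomial_dvd h k" using x(1) by blast
    qed
  qed
qed

lemma linear_resolution_empty:
  "linear_resolution V d (mono_ideal V {} :: ('v, 'k::field) mpoly set) (\<lambda>_. 0)"
proof -
  have "(mono_ideal V {} :: ('v, 'k) mpoly set) = {0}"
    by (auto simp: mono_ideal_def poly.zero_closed)
  then show ?thesis using linear_resolution_zero[of V d] by simp
qed

text \<open>The ranks are those of the Koszul complex. A new variable \<open>x\<close> is a nonzerodivisor modulo the
preceding ones, so the colon ideal by \<open>x\<close> is the ideal already present; the induction hypothesis
serves for both ingredients of the step, and the ranks follow Pascal's rule.\<close>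

lemma linear_resolution_variables:
  assumes "finite Q" "Q \<subseteq> V"
  shows "linear_resolution V 1 (mono_ideal V (mvar ` Q) :: ('v, 'k::field) mpoly set)
    (\<lambda>p. card Q choose Suc p)"
  using assms
proof (induct Q rule: finite_induct)
  case empty
  show ?case using linear_resolution_empty[of V 1] by simp
next
  case (insert x Q)
  then have IH: "linear_resolution V 1 (mono_ideal V (mvar ` Q) :: ('v, 'k) mpoly set) (\<lambda>p. card Q choose Suc p)"
    by simp
  have "linear_resolution V 1 (mono_ideal V (insert (mvar x) (mvar ` Q)) :: ('v, 'k) mpoly set)
    (\<lambda>p. (card Q choose Suc p) + (case p of 0 \<Rightarrow> 1 | Suc q \<Rightarrow> card Q choose Suc q))"
  proof (rule linear_quotient_step[OF IH IH])
    show "Poly_Mapping.keys (mvar x) \<subseteq> V" "total_degree (mvar x) = 1"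
      using insert(4) by (simp_all add: total_degree_single)
    show "\<exists>y\<in>Q. Poly_Mapping.lookup (mvar x) y < Poly_Mapping.lookup g y" if "g \<in> mvar ` Q" for g
      using that insert(2) by (auto simp: lookup_single when_def)
    show "\<exists>g\<in>mvar ` Q. monomial_dvd g (mvar x + mvar y)" if "y \<in> Q" for y
      using that monomial_dvd_add_right[of "mvar y" "mvar x"] by blast
  qed
  moreover have "(card Q choose Suc p) + (case p of 0 \<Rightarrow> 1 | Suc q \<Rightarrow> card Q choose Suc q) =
    card (insert x Q) choose Suc p" for p
    using insert(1,2) by (cases p) simp_all
  ultimately show ?case by simp
qed

text \<open>The index set is ordered only by the weight \<open>w\<close>, and elements of equal weight may be added in any
order. The first condition on \<open>Q\<close> is therefore imposed for ties as well, while the second one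
asks for a strictly lighter \<open>b\<close>, which has been added before \<open>a\<close> in every such order.\<close>

theorem linear_resolution_linear_quotients:
  fixes e :: "'b \<Rightarrow> 'v \<Rightarrow>\<^sub>0 nat" and w :: "'b \<Rightarrow> nat"
  assumes "finite A" and "\<And>a. a \<in> A \<Longrightarrow> Poly_Mapping.keys (e a) \<subseteq> V" and "\<And>a. a \<in> A \<Longrightarrow> total_degree (e a) = d"
    and "\<And>a. a \<in> A \<Longrightarrow> finite (Q a) \<and> Q a \<subseteq> V"
    and "\<And>a b. a \<in> A \<Longrightarrow> b \<in> A \<Longrightarrow> b \<noteq> a \<Longrightarrow> w b \<le> w a \<Longrightarrow>
      \<exists>x\<in>Q a. Poly_Mapping.lookup (e a) x < Poly_Mapping.lookup (e b) x"
    and "\<And>a x. a \<in> A \<Longrightarrow> x \<in> Q a \<Longrightarrow> \<exists>b\<in>A. w b < w a \<and> monomial_dvd (e b) (e a + mvar x)"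
  shows "linear_resolution V d (mono_ideal V (e ` A) :: ('v, 'k::field) mpoly set)
    (\<lambda>p. \<Sum>a\<in>A. card (Q a) choose p)"
  using assms
proof (induct A rule: finite_psubset_induct)
  case (psubset A)
  show ?case
  proof (cases "A = {}")
    case True
    then show ?thesis using linear_resolution_empty by simp
  next
    case False
    have "Max (w ` A) \<in> w ` A" using False psubset(1) by simp
    then obtain a where a: "a \<in> A" "w a = Max (w ` A)" by auto
    have max: "w b \<le> w a" if "b \<in> A" for b using a psubset(1) that by simp
    let ?A = "A - {a}"
    have IH: "linear_resolution V d (mono_ideal V (e ` ?A) :: ('v, 'k) mpoly set) (\<lambda>p. \<Sum>b\<in>?A. card (Q b) choose p)"
    proof (rule psubset(2))
      show "?A \<subset> A" using a by blast
      fix b x assume b: "b \<in> ?A" and x: "x \<in> Q b"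
      then obtain c where c: "c \<in> A" "w c < w b" "monomial_dvd (e c) (e b + mvar x)" using psubset(7)[of b x] by blast
      have "c \<noteq> a" using c(2) max[of b] b by auto
      with c show "\<exists>c\<in>?A. w c < w b \<and> monomial_dvd (e c) (e b + mvar x)" by blast
    qed (use psubset in auto)
    have "linear_resolution V d (mono_ideal V (insert (e a) (e ` ?A)) :: ('v, 'k) mpoly set)
      (\<lambda>p. (\<Sum>b\<in>?A. card (Q b) choose p) + (case p of 0 \<Rightarrow> 1 | Suc q \<Rightarrow> card (Q a) choose Suc q))"
    proof (rule linear_quotient_step[OF IH linear_resolution_variables])
      show "finite (Q a)" "Q a \<subseteq> V" using psubset(5)[OF a(1)] by auto
      show "Poly_Mapping.keys (e a) \<subseteq> V" "total_degree (e a) = d" using psubset(3,4)[OF a(1)] by auto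
      show "\<exists>x\<in>Q a. Poly_Mapping.lookup (e a) x < Poly_Mapping.lookup g x" if "g \<in> e ` ?A" for g
        using that psubset(6)[OF a(1)] max by blast
      fix x assume "x \<in> Q a"
      then obtain b where "b \<in> A" "w b < w a" "monomial_dvd (e b) (e a + mvar x)" using psubset(7)[OF a(1)] by blast
      then show "\<exists>g\<in>e ` ?A. monomial_dvd g (e a + mvar x)" by blast
    qed
    moreover have "insert (e a) (e ` ?A) = e ` A" using a(1) by blast
    moreover have "(\<Sum>b\<in>?A. card (Q b) choose p) + (case p of 0 \<Rightarrow> 1 | Suc q \<Rightarrow> card (Q a) choose Suc q) =
      (\<Sum>b\<in>A. card (Q b) choose p)" for p
      using sum.remove[OF psubset(1) a(1), of "\<lambda>b. card (Q b) choose p"] by (cases p) simp_all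
    ultimately show ?thesis by simp
  qed
qed

section \<open>Colexicographic order\<close>

lemma d_subsetsD:
  assumes "S \<in> d_subsets d"
  shows "finite S" "card S = d" "0 \<notin> S" "length (sorted_list_of_set S) = d"
  using assms by (auto simp: d_subsets_def)

lemma d_subsets_nth_last:
  assumes S: "S \<in> d_subsets d" and d: "d > 0"
  shows "sorted_list_of_set S ! (d - 1) = Max S"
proof (rule antisym)
  have fin: "finite S" and ne: "S \<noteq> {}" and len: "length (sorted_list_of_set S) = d"
    using d_subsetsD[OF S] d by auto
  have "sorted_list_of_set S ! (d - 1) \<in> set (sorted_list_of_set S)"
    by (rule nth_mem) (use len d in simp)
  then show "sorted_list_of_set S ! (d - 1) \<le> Max S" using fin by simp
  have "Max S \<in> set (sorted_list_of_set S)" using fin ne by simp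
  then obtain i where "i < d" "Max S = sorted_list_of_set S ! i" using len by (metis in_set_conv_nth)
  then show "Max S \<le> sorted_list_of_set S ! (d - 1)"
    using sorted_nth_mono[OF sorted_sorted_list_of_set[of S], of i "d - 1"] len by simp
qed

text \<open>The last position in which the increasing enumerations differ decides.\<close>

lemma colex_less_total:
  assumes S: "S \<in> d_subsets d" and T: "T \<in> d_subsets d" and "S \<noteq> T"
  shows "colex_less d S T \<or> colex_less d T S"
proof -
  let ?s = "sorted_list_of_set S" and ?t = "sorted_list_of_set T"
  have "?s \<noteq> ?t" using assms d_subsetsD(1) by (metis sorted_list_of_set_inject)
  then have "{m. m < d \<and> ?s ! m \<noteq> ?t ! m} \<noteq> {}"
    using d_subsetsD(4)[OF S] d_subsetsD(4)[OF T] nth_equalityI[of ?s ?t] by auto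
  moreover have fin: "finite {m. m < d \<and> ?s ! m \<noteq> ?t ! m}" by simp
  ultimately have "Max {m. m < d \<and> ?s ! m \<noteq> ?t ! m} \<in> {m. m < d \<and> ?s ! m \<noteq> ?t ! m}" by (rule Max_in[rotated])
  moreover define m where "m = Max {m. m < d \<and> ?s ! m \<noteq> ?t ! m}"
  ultimately have m: "m < d" "?s ! m \<noteq> ?t ! m" by auto
  have "?s ! j = ?t ! j" if "m < j" "j < d" for j
    using Max_ge[OF fin, of j] that unfolding m_def by (metis (mono_tags, lifting) leD mem_Collect_eq)
  with m show ?thesis unfolding colex_less_def by (metis linorder_neqE_nat)
qed

lemma colex_less_irrefl: "\<not> colex_less d S S"
  by (simp add: colex_less_def)

lemma colex_less_trans:
  assumes "colex_less d S T" "colex_less d T U"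
  shows "colex_less d S U"
proof -
  let ?s = "sorted_list_of_set S" and ?t = "sorted_list_of_set T" and ?u = "sorted_list_of_set U"
  from assms(1) obtain m where m: "m < d" "?s ! m < ?t ! m" "\<And>j. m < j \<Longrightarrow> j < d \<Longrightarrow> ?s ! j = ?t ! j"
    unfolding colex_less_def by blast
  from assms(2) obtain n where n: "n < d" "?t ! n < ?u ! n" "\<And>j. n < j \<Longrightarrow> j < d \<Longrightarrow> ?t ! j = ?u ! j"
    unfolding colex_less_def by blast
  have "?s ! max m n < ?u ! max m n"
    using m n by (cases m n rule: linorder_cases) (auto simp: max_def)
  moreover have "?s ! j = ?u ! j" if "max m n < j" "j < d" for j using m(3) n(3) that by simp
  ultimately show ?thesis unfolding colex_less_def using m(1) n(1) by (intro exI[of _ "max m n"]) simp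
qed

lemma colex_less_imp_Max_le:
  assumes S: "S \<in> d_subsets d" and T: "T \<in> d_subsets d" and less: "colex_less d S T"
  shows "Max S \<le> Max T"
proof -
  from less obtain m where m: "m < d" "sorted_list_of_set S ! m < sorted_list_of_set T ! m"
    "\<And>j. m < j \<Longrightarrow> j < d \<Longrightarrow> sorted_list_of_set S ! j = sorted_list_of_set T ! j"
    unfolding colex_less_def by blast
  have "sorted_list_of_set S ! (d - 1) \<le> sorted_list_of_set T ! (d - 1)"
    using m by (cases "m = d - 1") auto
  then show ?thesis using d_subsets_nth_last[OF S] d_subsets_nth_last[OF T] m(1) by simp
qed

lemma Max_less_imp_colex_less:
  assumes S: "S \<in> d_subsets d" and T: "T \<in> d_subsets d" and d: "d > 0" and less: "Max S < Max T"
  shows "colex_less d S T"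
  unfolding colex_less_def
  using d_subsets_nth_last[OF S d] d_subsets_nth_last[OF T d] less d by (intro exI[of _ "d - 1"]) auto

text \<open>A set in \<open>C - T\<close> precedes every set in \<open>T - C\<close> in colex order, so its maximum is not larger. Any
bijection between the two differences then compares the sums termwise.\<close>

lemma colex_initial_segment_Max_minimal:
  fixes g :: "nat \<Rightarrow> nat"
  assumes C: "colex_initial_segment d C" "finite C" and T: "T \<subseteq> d_subsets d" "finite T"
    and card: "card T = card C" and g: "mono g"
  shows "(\<Sum>S\<in>C. g (Max S)) \<le> (\<Sum>S\<in>T. g (Max S))"
proof -
  have Cd: "C \<subseteq> d_subsets d" using C(1) by (simp add: colex_initial_segment_def)
  have "card (C - T) = card (T - C)"
    using C(2) T(2) card by (simp add: card_Diff_subset_Int Int_commute)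
  then obtain h where h: "bij_betw h (C - T) (T - C)"
    using finite_same_card_bij[of "C - T" "T - C"] C(2) T(2) by auto
  have le: "Max S \<le> Max (h S)" if S: "S \<in> C - T" for S
  proof -
    have hS: "h S \<in> T - C" using h S by (auto simp: bij_betw_def)
    then have "\<not> colex_less d (h S) S"
      using C(1) S T(1) by (auto simp: colex_initial_segment_def)
    moreover have "S \<noteq> h S" using S hS by auto
    ultimately have "colex_less d S (h S)"
      using colex_less_total[of S d "h S"] S hS Cd T(1) by blast
    then show ?thesis using colex_less_imp_Max_le[of S d "h S"] S hS Cd T(1) by blast
  qed
  have "(\<Sum>S\<in>C - T. g (Max S)) \<le> (\<Sum>S\<in>C - T. g (Max (h S)))"
    using le g by (intro sum_mono) (auto dest: monoD)
  also have "\<dots> = (\<Sum>S\<in>T - C. g (Max S))" by (rule sum.reindex_bij_betw[OF h])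
  finally have "(\<Sum>S\<in>C - T. g (Max S)) \<le> (\<Sum>S\<in>T - C. g (Max S))" .
  moreover have "(\<Sum>S\<in>C. g (Max S)) = (\<Sum>S\<in>C \<inter> T. g (Max S)) + (\<Sum>S\<in>C - T. g (Max S))"
    using sum.Int_Diff[OF C(2)] .
  moreover have "(\<Sum>S\<in>T. g (Max S)) = (\<Sum>S\<in>C \<inter> T. g (Max S)) + (\<Sum>S\<in>T - C. g (Max S))"
    using sum.Int_Diff[OF T(2), of _ C] by (simp add: Int_commute)
  ultimately show ?thesis by simp
qed

text \<open>Initial segments of a total order are nested.\<close>

lemma colex_initial_segment_unique:
  assumes C: "colex_initial_segment d C" "finite C" and C': "colex_initial_segment d C'" "finite C'"
    and card: "card C = card C'"
  shows "C = C'"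
proof -
  have "C \<subseteq> C' \<or> C' \<subseteq> C"
  proof (rule ccontr)
    assume "\<not> (C \<subseteq> C' \<or> C' \<subseteq> C)"
    then obtain S T where "S \<in> C" "S \<notin> C'" "T \<in> C'" "T \<notin> C" by blast
    then show False
      using colex_less_total[of S d T] C(1) C'(1) unfolding colex_initial_segment_def by blast
  qed
  then show ?thesis using card_subset_eq[of C C'] card_subset_eq[of C' C] C(2) C'(2) card by auto
qed

lemma finite_colex_less:
  assumes S: "S \<in> d_subsets d"
  shows "finite {T \<in> d_subsets d. colex_less d T S}"
proof (rule finite_subset)
  show "{T \<in> d_subsets d. colex_less d T S} \<subseteq> Pow {..Max S}"
  proof
    fix T assume "T \<in> {T \<in> d_subsets d. colex_less d T S}"
    then have T: "T \<in> d_subsets d" and le: "Max T \<le> Max S" using colex_less_imp_Max_le[OF _ S] by auto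
    show "T \<in> Pow {..Max S}" using Max_ge[OF d_subsetsD(1)[OF T]] le by (auto intro: order_trans)
  qed
qed simp

text \<open>A segment is enlarged by the least set outside it. Since colex order is transitive with finite
initial parts, the number of predecessors is strictly monotone, and a set outside the segment
with the fewest predecessors is least.\<close>

lemma colex_initial_segment_exists:
  assumes d: "d > 0"
  shows "\<exists>C. finite C \<and> colex_initial_segment d C \<and> card C = n"
proof (induct n)
  case 0
  show ?case by (intro exI[of _ "{}"]) (simp add: colex_initial_segment_def)
next
  case (Suc n)
  then obtain C where C: "finite C" "colex_initial_segment d C" "card C = n" by blast
  have Cd: "C \<subseteq> d_subsets d" using C(2) by (simp add: colex_initial_segment_def)
  have "finite (\<Union>C)" using C(1) Cd d_subsetsD(1) by blast
  then obtain M where M: "\<And>x. x \<in> \<Union>C \<Longrightarrow> x \<le> M" by (metis finite_nat_set_iff_bounded_le)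
  have "{M + 1..<M + 1 + d} \<in> d_subsets d" by (auto simp: d_subsets_def)
  moreover have "{M + 1..<M + 1 + d} \<notin> C"
  proof
    assume "{M + 1..<M + 1 + d} \<in> C"
    then have "M + 1 \<in> \<Union>C" using d by (intro UnionI) auto
    then show False using M by force
  qed
  ultimately have ex: "\<exists>S. S \<in> d_subsets d - C" by blast
  define rank where "rank S = card {T \<in> d_subsets d. colex_less d T S}" for S
  obtain S where S: "S \<in> d_subsets d - C" and min: "\<And>T. T \<in> d_subsets d - C \<Longrightarrow> rank S \<le> rank T"
    using ex_has_least_nat[of "\<lambda>S. S \<in> d_subsets d - C" _ rank] ex by metis
  have below: "T \<in> C" if T: "T \<in> d_subsets d" "colex_less d T S" for T
  proof (rule ccontr)
    assume "T \<notin> C"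
    with T min have "rank S \<le> rank T" by blast
    moreover have "{U \<in> d_subsets d. colex_less d U T} \<subset> {U \<in> d_subsets d. colex_less d U S}"
      using T colex_less_trans[OF _ T(2)] colex_less_irrefl[of d T] by blast
    then have "rank T < rank S" unfolding rank_def using S by (intro psubset_card_mono finite_colex_less) auto
    ultimately show False by simp
  qed
  have "colex_initial_segment d (insert S C)"
    using C(2) S below unfolding colex_initial_segment_def by blast
  moreover have "card (insert S C) = Suc n" using C S by simp
  ultimately show ?case using C(1) by blast
qed

section \<open>Squarefree monomials\<close>

lemma prod_var: "(\<Prod>x\<in>S. var (h x)) = (Poly_Mapping.single (\<Sum>x\<in>S. mvar (h x)) 1 :: ('v, 'k::field) mpoly)"
  by (induct S rule: infinite_finite_induct) (simp_all add: var_def mult_single)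

lemma lookup_sum_mvar:
  "finite S \<Longrightarrow> inj_on h S \<Longrightarrow> Poly_Mapping.lookup (\<Sum>x\<in>S. mvar (h x)) v = (if v \<in> h ` S then 1 else 0)"
proof (induct S rule: finite_induct)
  case (insert x S)
  then show ?case by (auto simp: lookup_add lookup_single when_def)
qed simp

lemma total_degree_sum_mvar: "total_degree (\<Sum>x\<in>S. mvar (h x)) = card S"
  by (simp add: total_degree_sum total_degree_single)

lemma keys_sum_mvar: "Poly_Mapping.keys (\<Sum>x\<in>S. mvar (h x)) \<subseteq> h ` S"
  using keys_sum[of "\<lambda>x. mvar (h x)" S] by (auto split: if_splits)

section \<open>Colexsegment-generated ideals\<close>

definition set_monomial :: "nat set \<Rightarrow> nat \<Rightarrow>\<^sub>0 nat" where
  "set_monomial S = (\<Sum>i\<in>S. mvar i)"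

lemma lookup_set_monomial:
  "finite S \<Longrightarrow> Poly_Mapping.lookup (set_monomial S) v = (if v \<in> S then 1 else 0)"
  using lookup_sum_mvar[of S "\<lambda>i. i" v] by (simp only: set_monomial_def inj_on_id2 image_ident)

lemma keys_set_monomial: "Poly_Mapping.keys (set_monomial S) \<subseteq> S"
  using keys_sum_mvar[of "\<lambda>i. i" S] unfolding set_monomial_def image_ident .

lemma total_degree_set_monomial: "total_degree (set_monomial S) = card S"
  unfolding set_monomial_def by (rule total_degree_sum_mvar)

lemma prod_var_set: "(\<Prod>i\<in>S. var i) = (Poly_Mapping.single (set_monomial S) 1 :: (nat, 'k::field) mpoly)"
  unfolding set_monomial_def by (rule prod_var)

lemma colex_ideal_eq_mono_ideal:
  assumes "\<Union>C \<subseteq> V"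
  shows "genideal (poly_ring V) ((\<lambda>S. \<Prod>i\<in>S. var i) ` C) =
    (mono_ideal V (set_monomial ` C) :: (nat, 'k::field) mpoly set)"
proof -
  have "Poly_Mapping.keys (set_monomial S) \<subseteq> V" if "S \<in> C" for S
    using keys_set_monomial[of S] assms that by blast
  then have "genideal (poly_ring V) ((\<lambda>g. Poly_Mapping.single g (1::'k)) ` set_monomial ` C) =
      mono_ideal V (set_monomial ` C)"
    by (intro genideal_monomials) blast
  moreover have "(\<lambda>g. Poly_Mapping.single g (1::'k)) ` set_monomial ` C = (\<lambda>S. \<Prod>i\<in>S. var i) ` C"
    by (simp only: image_image prod_var_set)
  ultimately show ?thesis by (simp only:)
qed

lemma inj_on_set_monomial: "(\<And>S. S \<in> C \<Longrightarrow> finite S) \<Longrightarrow> inj_on set_monomial C"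
proof (rule inj_onI)
  fix S T assume fin: "\<And>S. S \<in> C \<Longrightarrow> finite S" and ST: "S \<in> C" "T \<in> C" "set_monomial S = set_monomial T"
  have "v \<in> S \<longleftrightarrow> v \<in> T" for v
  proof -
    have "(if v \<in> S then 1 else 0 :: nat) = Poly_Mapping.lookup (set_monomial T) v"
      unfolding ST(3)[symmetric] by (rule lookup_set_monomial[OF fin[OF ST(1)], symmetric])
    also have "\<dots> = (if v \<in> T then 1 else 0)" by (rule lookup_set_monomial[OF fin[OF ST(2)]])
    finally show ?thesis by (simp split: if_splits)
  qed
  then show "S = T" by blast
qed

lemma card_min_gens_colex:
  assumes C: "colex_initial_segment d C" "\<Union>C \<subseteq> V"
  shows "card (min_gens (mono_ideal V (set_monomial ` C) :: (nat, 'k::field) mpoly set)) = card C"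
proof -
  have S: "finite S \<and> card S = d" if "S \<in> C" for S
    using C(1) that d_subsetsD(1,2) by (auto simp: colex_initial_segment_def)
  have "min_gens (mono_ideal V (set_monomial ` C) :: (nat, 'k) mpoly set) = set_monomial ` C"
  proof (rule min_gens_mono_ideal)
    fix g assume "g \<in> set_monomial ` C"
    then obtain S where g: "S \<in> C" "g = set_monomial S" by blast
    show "Poly_Mapping.keys g \<subseteq> V"
      using keys_set_monomial[of S] C(2) g by blast
    show "total_degree g = d" using S[OF g(1)] g(2) by (simp add: total_degree_set_monomial)
  qed
  then show ?thesis using card_image[OF inj_on_set_monomial] S by simp
qed

text \<open>If two distinct sets of the segment satisfy \<open>Max T \<le> Max S\<close>, then \<open>T\<close> has an element outside
\<open>S\<close> because both have \<open>d\<close> elements, and this element is smaller than \<open>Max S\<close>. Conversely, exchanging \<open>Max S\<close>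
for a smaller positive number outside \<open>S\<close> leads to an earlier set, which belongs to the segment.\<close>

lemma colex_linear_resolution:
  assumes d: "d > 0" and C: "finite C" "colex_initial_segment d C" "\<Union>C \<subseteq> V"
  shows "linear_resolution V d (mono_ideal V (set_monomial ` C) :: (nat, 'k::field) mpoly set)
    (\<lambda>p. \<Sum>S\<in>C. (Max S - d) choose p)"
proof -
  have Cd: "S \<in> d_subsets d" if "S \<in> C" for S using C(2) that by (auto simp: colex_initial_segment_def)
  have SV: "S \<subseteq> V" if "S \<in> C" for S using C(3) that by blast
  have fin: "finite S" and card: "card S = d" and pos: "0 \<notin> S" and ne: "S \<noteq> {}" if "S \<in> C" for S
    using d_subsetsD[OF Cd[OF that]] d by auto
  have MaxS: "Max S \<in> S" if "S \<in> C" for S using fin[OF that] ne[OF that] by simp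
  define Q where "Q S = {1..<Max S} - S" for S :: "nat set"
  have swap: "insert v (S - {Max S}) \<in> C \<and> Max (insert v (S - {Max S})) < Max S" if S: "S \<in> C" and v: "v \<in> Q S" for S v
  proof -
    let ?T = "insert v (S - {Max S})"
    have v': "v \<notin> S" "1 \<le> v" "v < Max S" using v by (auto simp: Q_def)
    have "x < Max S" if "x \<in> ?T" for x using that v'(3) Max_ge[OF fin[OF S], of x] by auto
    then have less: "Max ?T < Max S" using fin[OF S] by simp
    have "card ?T = d" using fin[OF S] v'(1) MaxS[OF S] card[OF S] d by simp
    then have "?T \<in> d_subsets d" using fin[OF S] pos[OF S] v'(2) Cd[OF S] by (auto simp: d_subsets_def)
    then show ?thesis using Max_less_imp_colex_less[OF _ Cd[OF S] d less] less C(2) S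
      unfolding colex_initial_segment_def by blast
  qed
  have QV: "Q S \<subseteq> V" if "S \<in> C" for S using swap[OF that] SV by blast
  have cardQ: "card (Q S) = Max S - d" if S: "S \<in> C" for S
  proof -
    have "S - {Max S} \<subseteq> {1..<Max S}"
    proof
      fix x assume x: "x \<in> S - {Max S}"
      then have "x \<noteq> 0" using pos[OF S] by (metis DiffD1)
      moreover have "x < Max S" using x Max_ge[OF fin[OF S], of x] by auto
      ultimately show "x \<in> {1..<Max S}" by simp
    qed
    moreover have "Q S = {1..<Max S} - (S - {Max S})" by (auto simp: Q_def)
    ultimately have "card (Q S) = (Max S - 1) - (d - 1)"
      using fin[OF S] card[OF S] MaxS[OF S] by (simp add: card_Diff_subset)
    then show ?thesis using d by simp
  qed
  have "linear_resolution V d (mono_ideal V (set_monomial ` C) :: (nat, 'k) mpoly set)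
    (\<lambda>p. \<Sum>S\<in>C. card (Q S) choose p)"
  proof (rule linear_resolution_linear_quotients[where w = Max, OF C(1)])
    fix S assume S: "S \<in> C"
    show "Poly_Mapping.keys (set_monomial S) \<subseteq> V"
      using keys_set_monomial[of S] SV[OF S] by blast
    show "total_degree (set_monomial S) = d"
      using card[OF S] by (simp add: total_degree_set_monomial)
    show "finite (Q S) \<and> Q S \<subseteq> V" using QV[OF S] by (simp add: Q_def)
    show "\<exists>x\<in>Q S. Poly_Mapping.lookup (set_monomial S) x < Poly_Mapping.lookup (set_monomial T) x"
      if T: "T \<in> C" "T \<noteq> S" "Max T \<le> Max S" for T
    proof -
      have "\<not> T \<subseteq> S" using card_subset_eq[OF fin[OF S], of T] card[OF S] card[OF T(1)] T(2) by auto
      then obtain x where x: "x \<in> T" "x \<notin> S" by blast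
      have "x \<le> Max S" using Max_ge[OF fin[OF T(1)] x(1)] T(3) by simp
      moreover have "x \<noteq> Max S" using x(2) MaxS[OF S] by auto
      moreover have "x \<noteq> 0" using x(1) pos[OF T(1)] by metis
      ultimately have "x \<in> Q S" using x(2) by (simp add: Q_def)
      then show ?thesis
        using x by (intro bexI[of _ x]) (simp_all add: lookup_set_monomial fin S T)
    qed
    show "\<exists>T\<in>C. Max T < Max S \<and> monomial_dvd (set_monomial T) (set_monomial S + mvar x)" if x: "x \<in> Q S" for x
    proof (intro bexI conjI)
      let ?T = "insert x (S - {Max S})"
      show "?T \<in> C" "Max ?T < Max S" using swap[OF S x] by auto
      show "monomial_dvd (set_monomial ?T) (set_monomial S + mvar x)"
        using fin[OF S] by (auto simp: monomial_dvd_def lookup_add lookup_set_monomial lookup_single when_def)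
    qed
  qed
  moreover have "(\<Sum>S\<in>C. card (Q S) choose p) = (\<Sum>S\<in>C. (Max S - d) choose p)" for p
    by (rule sum.cong) (simp_all add: cardQ)
  ultimately show ?thesis by simp
qed

section \<open>Ferrers hypergraphs\<close>

locale ferrers =
  fixes d :: nat and X :: "nat \<Rightarrow> 'a set" and F :: "(nat \<Rightarrow> 'a) set" and le :: "nat \<Rightarrow> 'a rel"
  assumes edges: "F \<subseteq> (\<Pi>\<^sub>E j\<in>{1..d}. X j)" and finite_edges: "finite F"
    and linear: "j \<in> {1..d} \<Longrightarrow> linear_order_on (X j) (le j)"
    and down: "f \<in> F \<Longrightarrow> g \<in> (\<Pi>\<^sub>E j\<in>{1..d}. X j) \<Longrightarrow> (\<And>j. j \<in> {1..d} \<Longrightarrow> (g j, f j) \<in> le j) \<Longrightarrow> g \<in> F"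
begin

definition below :: "nat \<Rightarrow> 'a \<Rightarrow> 'a set" where
  "below j a = {b \<in> X j. (b, a) \<in> le j \<and> b \<noteq> a}"

definition weight :: "(nat \<Rightarrow> 'a) \<Rightarrow> nat" where
  "weight f = (\<Sum>j\<in>{1..d}. card (below j (f j)))"

lemma edge_vertex: "f \<in> F \<Longrightarrow> j \<in> {1..d} \<Longrightarrow> f j \<in> X j"
  using edges by blast

lemma edge_eqI: "f \<in> F \<Longrightarrow> g \<in> F \<Longrightarrow> (\<And>j. j \<in> {1..d} \<Longrightarrow> f j = g j) \<Longrightarrow> f = g"
  by (rule PiE_ext[OF subsetD[OF edges] subsetD[OF edges]])

lemma below_or_above:
  assumes "j \<in> {1..d}" "a \<in> X j" "b \<in> X j" "a \<noteq> b"
  shows "a \<in> below j b \<or> b \<in> below j a"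
  using linear[OF assms(1)] assms by (auto simp: below_def order_on_defs total_on_def)

lemma below_psubset:
  assumes j: "j \<in> {1..d}" and b: "b \<in> below j a"
  shows "below j b \<subset> below j a"
proof -
  have t: "trans (le j)" and a: "antisym (le j)" using linear[OF j] by (auto simp: order_on_defs)
  have "below j b \<subseteq> below j a"
    using b transD[OF t] antisymD[OF a] unfolding below_def by blast
  moreover have "b \<notin> below j b" by (simp add: below_def)
  ultimately show ?thesis using b by blast
qed

lemma edge_update:
  assumes f: "f \<in> F" and j: "j \<in> {1..d}" and b: "b \<in> below j (f j)"
  shows "f(j := b) \<in> F"
proof (rule down[OF f])
  show "f(j := b) \<in> (\<Pi>\<^sub>E j\<in>{1..d}. X j)"
    using PiE_fun_upd[OF _ subsetD[OF edges f], of b j] b unfolding insert_absorb[OF j] by (simp add: below_def)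
  fix i assume i: "i \<in> {1..d}"
  have "(f i, f i) \<in> le i"
    using linear[OF i] edge_vertex[OF f i] by (auto simp: order_on_defs refl_on_def)
  then show "((f(j := b)) i, f i) \<in> le i" using b by (simp add: below_def)
qed

text \<open>The class may be infinite, but each vertex below \<open>f j\<close> gives another edge, and there are only finitely many edges.\<close>

lemma finite_below:
  assumes f: "f \<in> F" and j: "j \<in> {1..d}"
  shows "finite (below j (f j))"
proof (rule inj_on_finite[OF _ _ finite_edges])
  show "inj_on (\<lambda>b. f(j := b)) (below j (f j))"
    by (rule inj_onI) (metis fun_upd_same)
  show "(\<lambda>b. f(j := b)) ` below j (f j) \<subseteq> F"
    using edge_update[OF f j] by blast
qed

lemma weight_update:
  assumes f: "f \<in> F" and j: "j \<in> {1..d}" and b: "b \<in> below j (f j)"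
  shows "weight (f(j := b)) < weight f"
  unfolding weight_def
proof (rule sum_strict_mono_ex1)
  have less: "card (below j b) < card (below j (f j))"
    by (rule psubset_card_mono[OF finite_below[OF f j] below_psubset[OF j b]])
  then show "\<forall>i\<in>{1..d}. card (below i ((f(j := b)) i)) \<le> card (below i (f i))" by simp
  show "\<exists>i\<in>{1..d}. card (below i ((f(j := b)) i)) < card (below i (f i))"
    using less j by (intro bexI[of _ j]) simp_all
qed simp

text \<open>If no vertex of \<open>g\<close> were below the corresponding one of \<open>f\<close>, the vertices of \<open>f\<close> would be the
smaller ones wherever the edges differ, and \<open>g\<close> would be strictly heavier.\<close>

lemma edge_differs_below:
  assumes f: "f \<in> F" and g: "g \<in> F" and ne: "g \<noteq> f" and w: "weight g \<le> weight f"
  shows "\<exists>j\<in>{1..d}. g j \<in> below j (f j)"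
proof (rule ccontr)
  assume none: "\<not> ?thesis"
  have sub: "below j (f j) \<subset> below j (g j)" if j: "j \<in> {1..d}" "f j \<noteq> g j" for j
    using below_or_above[OF j(1) edge_vertex[OF f j(1)] edge_vertex[OF g j(1)] j(2)] none j(1)
      below_psubset[OF j(1)] by blast
  have "weight f < weight g"
    unfolding weight_def
  proof (rule sum_strict_mono_ex1)
    have less: "card (below j (f j)) < card (below j (g j))" if "j \<in> {1..d}" "f j \<noteq> g j" for j
      by (rule psubset_card_mono[OF finite_below[OF g that(1)] sub[OF that]])
    show "\<forall>j\<in>{1..d}. card (below j (f j)) \<le> card (below j (g j))"
      using less by (metis order.refl less_imp_le)
    have "\<exists>j\<in>{1..d}. f j \<noteq> g j"
      using edge_eqI[OF f g] ne by blast
    then show "\<exists>j\<in>{1..d}. card (below j (f j)) < card (below j (g j))" using less by blast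
  qed simp
  with w show False by simp
qed

definition edge_monomial :: "(nat \<Rightarrow> 'a) \<Rightarrow> (nat \<times> 'a) \<Rightarrow>\<^sub>0 nat" where
  "edge_monomial f = (\<Sum>j\<in>{1..d}. mvar (j, f j))"

lemma lookup_edge_monomial:
  "Poly_Mapping.lookup (edge_monomial f) (j, a) = (if j \<in> {1..d} \<and> f j = a then 1 else 0)"
proof -
  have "inj_on (\<lambda>j. (j, f j)) {1..d}" by (rule inj_onI) simp
  then have "Poly_Mapping.lookup (edge_monomial f) (j, a) = (if (j, a) \<in> (\<lambda>j. (j, f j)) ` {1..d} then 1 else 0)"
    unfolding edge_monomial_def by (rule lookup_sum_mvar[OF finite_atLeastAtMost])
  also have "(j, a) \<in> (\<lambda>j. (j, f j)) ` {1..d} \<longleftrightarrow> j \<in> {1..d} \<and> f j = a" by blast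
  finally show ?thesis .
qed

lemma keys_edge_monomial: "f \<in> F \<Longrightarrow> Poly_Mapping.keys (edge_monomial f) \<subseteq> hypergraph_vars d X"
  unfolding edge_monomial_def hypergraph_vars_def
  by (rule order_trans[OF keys_sum_mvar]) (auto intro: edge_vertex)

lemma total_degree_edge_monomial: "total_degree (edge_monomial f) = d"
  unfolding edge_monomial_def total_degree_sum_mvar by simp

lemma inj_on_edge_monomial: "inj_on edge_monomial F"
proof (rule inj_onI)
  fix f g assume fg: "f \<in> F" "g \<in> F" "edge_monomial f = edge_monomial g"
  show "f = g"
  proof (rule edge_eqI[OF fg(1,2)])
    fix j assume j: "j \<in> {1..d}"
    have "Poly_Mapping.lookup (edge_monomial g) (j, f j) = 1"
      unfolding fg(3)[symmetric] lookup_edge_monomial using j by simp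
    then have "g j = f j" unfolding lookup_edge_monomial by (metis zero_neq_one)
    then show "f j = g j" ..
  qed
qed

lemma hypergraph_ideal_eq_mono_ideal:
  "hypergraph_ideal d X F =
    (mono_ideal (hypergraph_vars d X) (edge_monomial ` F) :: (nat \<times> 'a, 'k::field) mpoly set)"
proof -
  have "genideal (poly_ring (hypergraph_vars d X)) ((\<lambda>g. Poly_Mapping.single g (1::'k)) ` edge_monomial ` F) =
      mono_ideal (hypergraph_vars d X) (edge_monomial ` F)"
    using keys_edge_monomial by (intro genideal_monomials) blast
  moreover have "(\<lambda>g. Poly_Mapping.single g (1::'k)) ` edge_monomial ` F =
      (\<lambda>f. \<Prod>j\<in>{1..d}. var (j, f j)) ` F"
    by (simp only: image_image prod_var edge_monomial_def)
  ultimately show ?thesis unfolding hypergraph_ideal_def by (simp only:)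
qed

lemma card_min_gens: "card (min_gens (hypergraph_ideal d X F :: (nat \<times> 'a, 'k::field) mpoly set)) = card F"
proof -
  have "min_gens (mono_ideal (hypergraph_vars d X) (edge_monomial ` F) :: (nat \<times> 'a, 'k) mpoly set) =
      edge_monomial ` F"
  proof (rule min_gens_mono_ideal)
    fix g assume "g \<in> edge_monomial ` F"
    then obtain f where f: "f \<in> F" "g = edge_monomial f" by blast
    show "Poly_Mapping.keys g \<subseteq> hypergraph_vars d X" unfolding f(2) by (rule keys_edge_monomial[OF f(1)])
    show "total_degree g = d" unfolding f(2) by (rule total_degree_edge_monomial)
  qed
  then show ?thesis
    unfolding hypergraph_ideal_eq_mono_ideal by (simp only: card_image[OF inj_on_edge_monomial])
qed

text \<open>Linear quotients with respect to the order by weight: the colon ideal at \<open>f\<close> is generated by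
the variables of the vertices below those of \<open>f\<close>.\<close>

lemma linear_resolution_hypergraph_ideal:
  "linear_resolution (hypergraph_vars d X) d (hypergraph_ideal d X F :: (nat \<times> 'a, 'k::field) mpoly set)
    (\<lambda>p. \<Sum>f\<in>F. weight f choose p)"
proof -
  define Q where "Q f = (SIGMA j:{1..d}. below j (f j))" for f
  have "linear_resolution (hypergraph_vars d X) d
    (mono_ideal (hypergraph_vars d X) (edge_monomial ` F) :: (nat \<times> 'a, 'k) mpoly set)
    (\<lambda>p. \<Sum>f\<in>F. card (Q f) choose p)"
  proof (rule linear_resolution_linear_quotients[where w = weight, OF finite_edges keys_edge_monomial total_degree_edge_monomial])
    fix f assume f: "f \<in> F"
    show "finite (Q f) \<and> Q f \<subseteq> hypergraph_vars d X"
      using finite_below[OF f] by (auto simp: Q_def hypergraph_vars_def below_def)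
    show "\<exists>x\<in>Q f. Poly_Mapping.lookup (edge_monomial f) x < Poly_Mapping.lookup (edge_monomial g) x"
      if g: "g \<in> F" "g \<noteq> f" "weight g \<le> weight f" for g
    proof -
      from edge_differs_below[OF f g] obtain j where j: "j \<in> {1..d}" "g j \<in> below j (f j)" by blast
      then have "(j, g j) \<in> Q f" by (simp add: Q_def)
      moreover have "f j \<noteq> g j" using j(2) by (auto simp: below_def)
      ultimately show ?thesis
        using j(1) by (intro bexI[of _ "(j, g j)"]) (simp_all add: lookup_edge_monomial)
    qed
    show "\<exists>g\<in>F. weight g < weight f \<and> monomial_dvd (edge_monomial g) (edge_monomial f + mvar x)" if x: "x \<in> Q f" for x
    proof -
      obtain j b where jb: "x = (j, b)" "j \<in> {1..d}" "b \<in> below j (f j)" using x by (auto simp: Q_def)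
      have "monomial_dvd (edge_monomial (f(j := b))) (edge_monomial f + mvar x)"
        unfolding monomial_dvd_def
      proof
        fix v
        show "Poly_Mapping.lookup (edge_monomial (f(j := b))) v \<le> Poly_Mapping.lookup (edge_monomial f + mvar x) v"
          by (cases v) (simp add: lookup_add lookup_edge_monomial lookup_single jb(1) when_def)
      qed
      then show ?thesis using edge_update[OF f jb(2,3)] weight_update[OF f jb(2,3)] by blast
    qed
  qed
  moreover have "(\<Sum>f\<in>F. card (Q f) choose p) = (\<Sum>f\<in>F. weight f choose p)" for p
    by (rule sum.cong) (simp_all add: Q_def weight_def finite_below)
  ultimately show ?thesis unfolding hypergraph_ideal_eq_mono_ideal by simp
qed

text \<open>The \<open>j\<close>-th smallest element of the \<open>d\<close>-set that encodes \<open>f\<close>. The summand \<open>j\<close> makes the levels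
strictly increasing even if there are no vertices below those of \<open>f\<close>.\<close>

definition level :: "(nat \<Rightarrow> 'a) \<Rightarrow> nat \<Rightarrow> nat" where
  "level f j = (\<Sum>k\<in>{1..j}. card (below k (f k))) + j"

lemma strict_mono_level: "strict_mono (level f)"
  by (simp add: strict_mono_Suc_iff level_def)

lemma level_image_d_subsets: "level f ` {1..d} \<in> d_subsets d"
  using card_image[OF inj_on_subset[OF strict_mono_imp_inj_on[OF strict_mono_level] subset_UNIV], of f "{1..d}"]
  by (auto simp: d_subsets_def level_def)

lemma Max_level_image:
  assumes "d > 0"
  shows "Max (level f ` {1..d}) = weight f + d"
proof -
  have "Max (level f ` {1..d}) = level f d"
  proof (rule Max_eqI)
    fix y assume "y \<in> level f ` {1..d}"
    then obtain j where "y = level f j" "j \<le> d" by auto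
    then show "y \<le> level f d" using monoD[OF strict_mono_mono[OF strict_mono_level]] by simp
  next
    show "level f d \<in> level f ` {1..d}" using assms by (intro imageI) simp
  qed simp
  then show ?thesis by (simp add: level_def weight_def)
qed

text \<open>The set of levels determines its increasing enumeration, successive differences of the levels
give the number of vertices below each \<open>f j\<close>, and in a linear order this number determines
the vertex.\<close>

lemma inj_on_level_image: "inj_on (\<lambda>f. level f ` {1..d}) F"
proof (rule inj_onI)
  fix f g assume f: "f \<in> F" and g: "g \<in> F" and eq: "level f ` {1..d} = level g ` {1..d}"
  have sorted: "sorted_wrt (<) (map (level h) [1..<Suc d])" for h
    by (rule sorted_wrt_map_mono[OF sorted_wrt_upt]) (simp add: strict_monoD[OF strict_mono_level])
  have set: "set (map (level h) [1..<Suc d]) = level h ` {1..d}" for h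
    by (simp only: set_map set_upt atLeastLessThanSuc_atLeastAtMost)
  have "map (level f) [1..<Suc d] = map (level g) [1..<Suc d]"
    by (rule strict_sorted_equal[OF sorted sorted]) (simp only: set eq)
  then have level: "level f j = level g j" if "j \<in> {1..d}" for j
    using that by (simp del: upt_Suc)
  have card: "card (below j (f j)) = card (below j (g j))" if j: "j \<in> {1..d}" for j
  proof -
    obtain i where i: "j = Suc i" using j by (cases j) auto
    have "level f i = level g i"
    proof (cases "i = 0")
      case False
      then show ?thesis using level[of i] j i by simp
    qed (simp add: level_def)
    then show ?thesis using level[OF j] by (simp add: level_def i)
  qed
  show "f = g"
  proof (rule edge_eqI[OF f g], rule ccontr)
    fix j assume j: "j \<in> {1..d}" and ne: "f j \<noteq> g j"
    from below_or_above[OF j edge_vertex[OF f j] edge_vertex[OF g j] ne]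
    have "card (below j (f j)) \<noteq> card (below j (g j))"
    proof
      assume "f j \<in> below j (g j)"
      from psubset_card_mono[OF finite_below[OF g j] below_psubset[OF j this]] show ?thesis by simp
    next
      assume "g j \<in> below j (f j)"
      from psubset_card_mono[OF finite_below[OF f j] below_psubset[OF j this]] show ?thesis by simp
    qed
    with card[OF j] show False by simp
  qed
qed

lemma weight_sum_ge_colex:
  fixes i :: nat
  assumes d: "d > 0" and C: "finite C" "colex_initial_segment d C" and card: "card C = card F"
  shows "(\<Sum>S\<in>C. (Max S - d) choose i) \<le> (\<Sum>f\<in>F. weight f choose i)"
proof -
  let ?T = "(\<lambda>f. level f ` {1..d}) ` F"
  have "(\<Sum>S\<in>C. (Max S - d) choose i) \<le> (\<Sum>S\<in>?T. (Max S - d) choose i)"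
  proof (rule colex_initial_segment_Max_minimal[where g = "\<lambda>n. (n - d) choose i", OF C(2,1)])
    show "?T \<subseteq> d_subsets d" using level_image_d_subsets by blast
    show "finite ?T" using finite_edges by simp
    show "card ?T = card C" using card_image[OF inj_on_level_image] card by simp
    show "mono (\<lambda>n. (n - d) choose i)" by (intro monoI binomial_right_mono) simp
  qed
  also have "\<dots> = (\<Sum>f\<in>F. weight f choose i)"
    by (simp only: sum.reindex[OF inj_on_level_image] comp_def Max_level_image[OF d] add_diff_cancel_right')
  finally show ?thesis .
qed

end

text \<open>The Betti numbers of both ideals are known sums of binomial coefficients, and
\<open>weight_sum_ge_colex\<close> compares them. For the first part, the monomials that generate a
colexsegment-generated ideal are its minimal generators, so the number of minimal generators
determines the segment.\<close>

theorem proposition4p2: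
  fixes d :: nat
    and X :: "nat \<Rightarrow> 'a set"
    and F :: "(nat \<Rightarrow> 'a) set"
    and I :: "(nat \<times> 'a, 'k::field) mpoly set"
  assumes "d \<ge> 2"
    and "ferrers_hypergraph d X F"
    and "finite F"
    and "I = hypergraph_ideal d X F"
  shows "(\<exists>!J :: (nat, 'k) mpoly set.
            colexsegment_generated d {1..} J \<and> card (min_gens J) = card (min_gens I)) \<and>
         (\<forall>V \<subseteq> {1..}. \<forall>J :: (nat, 'k) mpoly set.
            colexsegment_generated d V J \<and> card (min_gens J) = card (min_gens I) \<longrightarrow>
            (\<forall>i. betti (hypergraph_vars d X) I i \<ge> betti V J i))"
proof -
  have d: "d > 0" using assms(1) by simp
  from assms(2) have edges: "F \<subseteq> (\<Pi>\<^sub>E j\<in>{1..d}. X j)"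
    unfolding ferrers_hypergraph_def by (rule conjunct1)
  from assms(2) obtain le :: "nat \<Rightarrow> 'a rel" where linear: "\<forall>j\<in>{1..d}. linear_order_on (X j) (le j)"
    and down: "\<forall>f\<in>F. \<forall>g\<in>(\<Pi>\<^sub>E j\<in>{1..d}. X j). (\<forall>j\<in>{1..d}. (g j, f j) \<in> le j) \<longrightarrow> g \<in> F"
    unfolding ferrers_hypergraph_def by (elim conjE exE)
  interpret ferrers d X F le
  proof
    show "g \<in> F" if "f \<in> F" "g \<in> (\<Pi>\<^sub>E j\<in>{1..d}. X j)" "\<And>j. j \<in> {1..d} \<Longrightarrow> (g j, f j) \<in> le j" for f g
      using down[rule_format, OF that] .
    show "linear_order_on (X j) (le j)" if "j \<in> {1..d}" for j
      using linear[rule_format, OF that] .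
  qed (fact edges assms(3))+
  have cardI: "card (min_gens I) = card F" unfolding assms(4) by (rule card_min_gens)
  have colex: "\<exists>C. finite C \<and> colex_initial_segment d C \<and> \<Union>C \<subseteq> V \<and>
      J = mono_ideal V (set_monomial ` C) \<and> card (min_gens J) = card C"
    if "colexsegment_generated d V J" for V and J :: "(nat, 'k) mpoly set"
  proof -
    from that obtain C where C: "finite C" "colex_initial_segment d C" "\<Union>C \<subseteq> V"
      "J = genideal (poly_ring V) ((\<lambda>S. \<Prod>i\<in>S. var i) ` C)"
      unfolding colexsegment_generated_def by (elim exE conjE)
    have J: "J = mono_ideal V (set_monomial ` C)"
      unfolding C(4) by (rule colex_ideal_eq_mono_ideal[OF C(3)])
    have "card (min_gens J) = card C"
      unfolding J by (rule card_min_gens_colex[OF C(2,3)])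
    with C(1-3) J show ?thesis by (intro exI[of _ C] conjI)
  qed
  obtain C where C: "finite C" "colex_initial_segment d C" "card C = card F"
    using colex_initial_segment_exists[OF d] by blast
  have CV: "\<Union>C \<subseteq> {1..}"
    using C(2) by (auto simp: colex_initial_segment_def d_subsets_def)
  let ?J = "mono_ideal {1..} (set_monomial ` C) :: (nat, 'k) mpoly set"
  have J: "colexsegment_generated d {1..} ?J"
    unfolding colexsegment_generated_def
    by (intro exI[of _ C] conjI C CV colex_ideal_eq_mono_ideal[OF CV, symmetric])
  have cardJ: "card (min_gens ?J) = card (min_gens I)"
    unfolding cardI using card_min_gens_colex[OF C(2) CV] C(3) by simp
  have uniq: "J = ?J" if "colexsegment_generated d {1..} J" "card (min_gens J) = card (min_gens I)"
    for J :: "(nat, 'k) mpoly set"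
  proof -
    from colex[OF that(1)] obtain C' where C': "finite C'" "colex_initial_segment d C'"
      "J = mono_ideal {1..} (set_monomial ` C')" "card (min_gens J) = card C'" by blast
    have "C' = C"
      using colex_initial_segment_unique[OF C'(2,1) C(2,1)] C'(4) C(3) that(2) cardI by simp
    then show ?thesis using C'(3) by simp
  qed
  have unique: "\<exists>!J :: (nat, 'k) mpoly set.
      colexsegment_generated d {1..} J \<and> card (min_gens J) = card (min_gens I)"
  proof (rule ex1I)
    show "colexsegment_generated d {1..} ?J \<and> card (min_gens ?J) = card (min_gens I)"
      using J cardJ by (rule conjI)
    fix J :: "(nat, 'k) mpoly set"
    assume "colexsegment_generated d {1..} J \<and> card (min_gens J) = card (min_gens I)"
    then show "J = ?J" by (elim conjE) (rule uniq)
  qed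
  have bound: "betti V J i \<le> betti (hypergraph_vars d X) I i"
    if J: "colexsegment_generated d V J" and cardJ: "card (min_gens J) = card (min_gens I)"
    for V and J :: "(nat, 'k) mpoly set" and i
  proof -
    from colex[OF J] obtain C where C: "finite C" "colex_initial_segment d C" "\<Union>C \<subseteq> V"
      "J = mono_ideal V (set_monomial ` C)" "card (min_gens J) = card C" by blast
    have "betti V J i = (\<Sum>S\<in>C. (Max S - d) choose i)"
      unfolding C(4) by (rule betti_linear_resolution[OF colex_linear_resolution[OF d C(1-3)]])
    also have "\<dots> \<le> (\<Sum>f\<in>F. weight f choose i)"
      using C(5) cardJ cardI by (intro weight_sum_ge_colex[OF d C(1,2)]) simp
    also have "\<dots> = betti (hypergraph_vars d X) I i"
      unfolding assms(4) by (rule betti_linear_resolution[OF linear_resolution_hypergraph_ideal, symmetric])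
    finally show ?thesis .
  qed
  show ?thesis
  proof (intro conjI unique allI impI)
    fix V and J :: "(nat, 'k) mpoly set" and i
    assume "colexsegment_generated d V J \<and> card (min_gens J) = card (min_gens I)"
    then show "betti V J i \<le> betti (hypergraph_vars d X) I i" by (elim conjE) (rule bound)
  qed
qed

end
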